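(* Let $|\Psi\rangle\in\mathcal{B}^n$ be a stabilizer state with full local ranks shared by three parties $M=\{A,B,C\}$, with stabilizer group $S$. Let $S_{loc}=S_{\hat A}+S_{\hat B}+S_{\hat C}$, $p=\dim(S)-\dim(S_{loc})$, and $d(\alpha)=\dim(S_{\hat\alpha})$ for $\alpha\in M$. Then $d(\alpha)-p$ is a non-negative even integer for each $\alpha$, and $|\Psi\rangle$ is LCU-equivalent to the tensor product of: $(d(A)-p)/2$ copies of $|\Psi^+\rangle$ shared by $B$ and $C$; $(d(B)-p)/2$ copies of $|\Psi^+\rangle$ shared by $C$ and $A$; $(d(C)-p)/2$ copies of $|\Psi^+\rangle$ shared by $A$ and $B$; and $p$ copies of $|\Psi_3^+\rangle$ shared by $A$, $B$, $C$ (one qubit each).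
   Context: Let $G^n\cong\mathbb{F}_2^{2n}$, with elements $f=(a_1,b_1,\dots,a_n,b_n)$; $\sigma_{00}=I,\sigma_{10}=\sigma^x,\sigma_{01}=\sigma^z,\sigma_{11}=\sigma^y$, $\sigma(f)=\sigma_{a_1b_1}\otimes\cdots\otimes\sigma_{a_nb_n}$ on $\mathcal{B}^n=(\mathbb{C}^2)^{\otimes n}$; symplectic form $\omega(f,f')=\sum_j(a_jb_j'+b_ja_j')\bmod 2$. A stabilizer state with stabilizer group $S$ ($S$ self-dual, i.e. $S=\{f:\omega(f,g)=0\ \forall g\in S\}$) is the unique up-to-phase unit vector with $\sigma(f)|\Psi\rangle=\epsilon(f)|\Psi\rangle$ for all $f\in S$ for fixed consistent signs. The Clifford group $\mathcal{C}(k)$ is the set of unitaries $U$ on $k$ qubits with $U\sigma(f)U^\dagger=\pm\sigma(u(f))$ for all $f$ for some map $u$. Party $\alpha$ holds $n_\alpha$ qubits, $n=\sum_\alpha n_\alpha$; $f_\alpha$ is the restriction of $f$ to party $\alpha$'s qubits; local subgroup $S_\alpha=\{g\in S:g_\beta=0\ \forall\beta\ne\alpha\}$, co-local subgroup $S_{\hat\alpha}=\{g\in S:g_\alpha=0\}$. Full local ranks: $S_\alpha=0$ for all $\alpha$. Two $M$-party states are LCU-equivalent if one equals $\bigotimes_\alpha U_\alpha$ applied to the other (up to global phase), $U_\alpha\in\mathcal{C}(n_\alpha)$ acting on party $\alpha$'s qubits. $|\Psi^+\rangle=\frac1{\sqrt2}(|00\rangle+|11\rangle)$ and $|\Psi_3^+\rangle=\frac1{\sqrt2}(|000\rangle+|111\rangle)$.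 *)

theory Defs
  imports "HOL-Analysis.Analysis" "HOL-Library.Z2" "HOL-Library.Function_Algebras"
begin

datatype party = PA | PB | PC

text \<open>Symplectic vectors: an element f of G^n is a function from qubit labels to
 pairs (a_q, b_q) over F_2 (type bit); qubits are labelled by elements of a finite set Q,
 and f vanishes outside Q.\<close>
type_synonym 'q symp = "'q \<Rightarrow> bit \<times> bit"

definition Gn :: "'q set \<Rightarrow> 'q symp set" where
  "Gn Q = {f. \<forall>q. q \<notin> Q \<longrightarrow> f q = 0}"

definition f2scale :: "bit \<Rightarrow> 'q symp \<Rightarrow> 'q symp" where
  "f2scale c f = (\<lambda>q. (c * fst (f q), c * snd (f q)))"

definition f2dim :: "'q symp set \<Rightarrow> nat" where
  "f2dim S = vector_space.dim f2scale S"

definition f2subspace :: "'q symp set \<Rightarrow> bool" where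
  "f2subspace S = (0 \<in> S \<and> (\<forall>f\<in>S. \<forall>g\<in>S. f + g \<in> S))"

definition omega :: "'q set \<Rightarrow> 'q symp \<Rightarrow> 'q symp \<Rightarrow> bit" where
  "omega Q f g = (\<Sum>q\<in>Q. fst (f q) * snd (g q) + snd (f q) * fst (g q))"

definition self_dual :: "'q set \<Rightarrow> 'q symp set \<Rightarrow> bool" where
  "self_dual Q S = (S = {f \<in> Gn Q. \<forall>g\<in>S. omega Q f g = 0})"

text \<open>States and operators on the qubits of a finite set R: computational basis states
 are labelled by the subset x \<subseteq> R of qubits in state |1>. A state is a map
 'q set \<Rightarrow> complex (only values on Pow R matter), an operator a matrix.\<close>
type_synonym 'q state = "'q set \<Rightarrow> complex"
type_synonym 'q op = "'q set \<Rightarrow> 'q set \<Rightarrow> complex"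

text \<open>Single-qubit Pauli matrices: sigma_00 = I, sigma_10 = X, sigma_01 = Z, sigma_11 = Y;
 entry <x|sigma_ab|y>.\<close>
definition sigma1 :: "bit \<times> bit \<Rightarrow> bool \<Rightarrow> bool \<Rightarrow> complex" where
  "sigma1 ab x y =
    (if ab = (0, 0) then (if x = y then 1 else 0)
     else if ab = (1, 0) then (if x \<noteq> y then 1 else 0)
     else if ab = (0, 1) then (if x = y then (if y then -1 else 1) else 0)
     else (if x \<noteq> y then (if y then - \<i> else \<i>) else 0))"

definition pauli :: "'q set \<Rightarrow> 'q symp \<Rightarrow> 'q op" where
  "pauli R f x y = (\<Prod>q\<in>R. sigma1 (f q) (q \<in> x) (q \<in> y))"

definition mmul :: "'q set \<Rightarrow> 'q op \<Rightarrow> 'q op \<Rightarrow> 'q op" where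
  "mmul R M N x y = (\<Sum>z\<in>Pow R. M x z * N z y)"

definition adj :: "'q op \<Rightarrow> 'q op" where
  "adj M x y = cnj (M y x)"

definition apply_op :: "'q set \<Rightarrow> 'q op \<Rightarrow> 'q state \<Rightarrow> 'q state" where
  "apply_op R M \<psi> x = (\<Sum>y\<in>Pow R. M x y * \<psi> y)"

definition unitary_op :: "'q set \<Rightarrow> 'q op \<Rightarrow> bool" where
  "unitary_op R U = (\<forall>x\<in>Pow R. \<forall>y\<in>Pow R.
      mmul R U (adj U) x y = (if x = y then 1 else 0) \<and>
      mmul R (adj U) U x y = (if x = y then 1 else 0))"

definition clifford :: "'q set \<Rightarrow> 'q op \<Rightarrow> bool" where
  "clifford R U = (unitary_op R U \<and>
     (\<exists>u. \<forall>f\<in>Gn R. u f \<in> Gn R \<and> (\<exists>s::complex. (s = 1 \<or> s = -1) \<and>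
        (\<forall>x\<in>Pow R. \<forall>y\<in>Pow R.
           mmul R (mmul R U (pauli R f)) (adj U) x y = s * pauli R (u f) x y))))"

definition unit_state :: "'q set \<Rightarrow> 'q state \<Rightarrow> bool" where
  "unit_state R \<psi> = ((\<Sum>x\<in>Pow R. (cmod (\<psi> x))\<^sup>2) = 1)"

definition stabilizer_state :: "'q set \<Rightarrow> 'q symp set \<Rightarrow> 'q state \<Rightarrow> bool" where
  "stabilizer_state Q S \<psi> = (finite Q \<and> S \<subseteq> Gn Q \<and> f2subspace S \<and> self_dual Q S \<and>
     unit_state Q \<psi> \<and>
     (\<exists>\<epsilon>::'q symp \<Rightarrow> complex. \<forall>f\<in>S. (\<epsilon> f = 1 \<or> \<epsilon> f = -1) \<and>
        (\<forall>x\<in>Pow Q. apply_op Q (pauli Q f) \<psi> x = \<epsilon> f * \<psi> x)))"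

definition qubits_of :: "'q set \<Rightarrow> ('q \<Rightarrow> party) \<Rightarrow> party \<Rightarrow> 'q set" where
  "qubits_of Q pty \<alpha> = {q \<in> Q. pty q = \<alpha>}"

definition local_sub :: "'q set \<Rightarrow> ('q \<Rightarrow> party) \<Rightarrow> 'q symp set \<Rightarrow> party \<Rightarrow> 'q symp set" where
  "local_sub Q pty S \<alpha> = {g \<in> S. \<forall>q\<in>Q. pty q \<noteq> \<alpha> \<longrightarrow> g q = 0}"

definition colocal_sub :: "'q set \<Rightarrow> ('q \<Rightarrow> party) \<Rightarrow> 'q symp set \<Rightarrow> party \<Rightarrow> 'q symp set" where
  "colocal_sub Q pty S \<alpha> = {g \<in> S. \<forall>q\<in>Q. pty q = \<alpha> \<longrightarrow> g q = 0}"

definition full_local_ranks :: "'q set \<Rightarrow> ('q \<Rightarrow> party) \<Rightarrow> 'q symp set \<Rightarrow> bool" where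
  "full_local_ranks Q pty S = (\<forall>\<alpha>. local_sub Q pty S \<alpha> = {0})"

definition S_loc :: "'q set \<Rightarrow> ('q \<Rightarrow> party) \<Rightarrow> 'q symp set \<Rightarrow> 'q symp set" where
  "S_loc Q pty S = {a + b + c | a b c. a \<in> colocal_sub Q pty S PA \<and>
                       b \<in> colocal_sub Q pty S PB \<and> c \<in> colocal_sub Q pty S PC}"

definition local_op :: "'q set \<Rightarrow> ('q \<Rightarrow> party) \<Rightarrow> (party \<Rightarrow> 'q op) \<Rightarrow> 'q op" where
  "local_op Q pty U x y =
     (\<Prod>\<alpha>\<in>UNIV. U \<alpha> (x \<inter> qubits_of Q pty \<alpha>) (y \<inter> qubits_of Q pty \<alpha>))"

definition LCU_equiv :: "'q set \<Rightarrow> ('q \<Rightarrow> party) \<Rightarrow> 'q state \<Rightarrow> 'q state \<Rightarrow> bool" where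
  "LCU_equiv Q pty \<psi> \<phi> = (\<exists>U. (\<forall>\<alpha>. clifford (qubits_of Q pty \<alpha>) (U \<alpha>)) \<and>
     (\<exists>c. cmod c = 1 \<and>
        (\<forall>x\<in>Pow Q. apply_op Q (local_op Q pty U) \<psi> x = c * \<phi> x)))"

text \<open>GHZ-type block state (|0..0> + |1..1>)/sqrt 2 on the qubits of blk:
 for a 2-element block this is |Psi+>, for a 3-element block |Psi3+>.\<close>
definition ghz_block :: "'q set \<Rightarrow> 'q state" where
  "ghz_block blk x = (if x \<inter> blk = {} \<or> blk \<subseteq> x then complex_of_real (1 / sqrt 2) else 0)"

definition block_product :: "'q set set \<Rightarrow> 'q state" where
  "block_product P x = (\<Prod>blk\<in>P. ghz_block blk x)"

definition pair_block :: "('q \<Rightarrow> party) \<Rightarrow> party \<Rightarrow> party \<Rightarrow> 'q set \<Rightarrow> bool" where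
  "pair_block pty \<alpha> \<beta> blk = (\<exists>q1 q2. blk = {q1, q2} \<and> pty q1 = \<alpha> \<and> pty q2 = \<beta>)"

definition triple_block :: "('q \<Rightarrow> party) \<Rightarrow> 'q set \<Rightarrow> bool" where
  "triple_block pty blk = (\<exists>a b c. blk = {a, b, c} \<and> pty a = PA \<and> pty b = PB \<and> pty c = PC)"

definition block_partition :: "'q set \<Rightarrow> 'q set set \<Rightarrow> bool" where
  "block_partition Q P = (\<Union>P = Q \<and> (\<forall>b1\<in>P. \<forall>b2\<in>P. b1 \<noteq> b2 \<longrightarrow> b1 \<inter> b2 = {}) \<and> {} \<notin> P)"

end

theory Submission
  imports Defs "HOL-Library.Set_Algebras"
begin

text \<open>A party-local transvection \<open>f \<mapsto> f + \<omega>(f,h) h\<close> of the stabilizer group is implemented by the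
 Clifford operator \<open>(1 + i \<sigma>(h)) / \<surd>2\<close>, and transvections carry any hyperbolic pair to
 \<open>(X\<^sub>q, Z\<^sub>q)\<close> for some qubit \<open>q\<close>. If two elements of \<open>S\<close> supported on parties \<open>\<alpha>, \<beta>\<close> have
 anticommuting restrictions to \<open>\<alpha>\<close>, they are moved to \<open>XX, ZZ\<close> and an EPR pair splits off.
 Otherwise the restrictions to \<open>\<alpha>\<close> of \<open>S \<inter> V\<^sub>\<alpha>\<^sub>\<beta>\<close> are orthogonal to each other; since their
 orthogonal complement in \<open>V\<^sub>\<alpha>\<close> is the restriction of \<open>S \<inter> V\<^sub>\<alpha>\<^sub>\<gamma>\<close>, there are \<open>z\<^sub>\<alpha> + z\<^sub>\<beta>\<close> and
 \<open>z\<^sub>\<alpha> + z\<^sub>\<gamma>\<close> in \<open>S\<close> with \<open>z\<^sub>\<alpha> \<noteq> 0\<close>, and together with any \<open>f \<in> S\<close> anticommuting with \<open>z\<^sub>\<alpha>\<close> they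
 are moved to \<open>ZZI, ZIZ, XXX\<close>, so that a GHZ state splits off. The numbers of blocks are read off from the
 cardinalities of the co-local subgroups, and the remaining signs are corrected by Pauli operators, which up to
 phase are squares of the above Clifford operators.\<close>

subsection \<open>Symplectic vectors and transvections\<close>

text \<open>Two obstacles shape the proof. The local unitaries have to be produced as explicit
  matrices, so no abstract lift of symplectic maps to Clifford operators is invoked: every
  symplectic map that occurs is a list of transvections, and only one type of gate has to be shown
  unitary and Clifford. The same list drives both sides, as \<open>trvs\<close> on the group and as
  \<open>rots\<close> on the state. Signs are the other obstacle: each gate changes them in a way
  that depends on phases of Pauli products. They stay existentially quantified until the group is in
  block form, where uniqueness of the stabilized state is a direct computation with amplitudes. The
  counts rest on the following orders. An EPR group has order 4 and lies in the co-local subgroup of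
  the absent party; a GHZ group has order 8, co-local subgroups of order 2, and these generate a
  subgroup of order 4. Orders multiply over disjoint blocks, which gives d(\<alpha>) = 2 n + p with
  n the number of pairs avoiding \<alpha>.\<close>

lemma bit_add_self [simp]: "(x::bit) + x = 0"
  by (cases x) simp_all

lemma bit_add_self_left [simp]: "(x::bit) + (x + y) = y"
  by (cases x; cases y) simp_all

lemma symp_add_self [simp]: "(f::'q symp) + f = 0"
  by (simp add: fun_eq_iff prod_eq_iff)

lemma symp_add_self_left [simp]: "(f::'q symp) + (f + g) = g"
  by (simp flip: add.assoc)

lemma UNIV_bit: "(UNIV :: bit set) = {0, 1}"
  by (metis (full_types) UNIV_eq_I bit_not_zero_iff insert_iff)

lemma UNIV_party: "(UNIV :: party set) = {PA, PB, PC}"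
  by (auto intro: party.exhaust)

lemma GnD: "f \<in> Gn R \<Longrightarrow> q \<notin> R \<Longrightarrow> f q = 0"
  by (simp add: Gn_def)

lemma Gn_mono: "R \<subseteq> R' \<Longrightarrow> Gn R \<subseteq> Gn R'"
  by (auto simp: Gn_def)

lemma Gn_zero [simp]: "0 \<in> Gn R"
  by (simp add: Gn_def)

lemma Gn_add: "f \<in> Gn R \<Longrightarrow> g \<in> Gn R \<Longrightarrow> f + g \<in> Gn R"
  by (simp add: Gn_def)

lemma finite_Gn:
  assumes "finite R"
  shows "finite (Gn R :: 'q symp set)"
proof -
  have "finite (UNIV :: bit set)"
    by (simp add: UNIV_bit)
  hence "finite (UNIV :: (bit \<times> bit) set)"
    by (simp add: finite_prod)
  hence "finite {f::'q symp. f ` UNIV \<subseteq> UNIV \<and> {x. f x \<noteq> 0} \<subseteq> R}"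
    by (intro finite_subset[OF _ finite_set_of_finite_funs[of R UNIV 0]])
       (auto simp: assms)
  thus ?thesis
    by (rule rev_finite_subset) (auto simp: Gn_def)
qed

definition restr :: "'q set \<Rightarrow> 'q symp \<Rightarrow> 'q symp" where
  "restr R f = (\<lambda>q. if q \<in> R then f q else 0)"

lemma restr_apply: "restr R f q = (if q \<in> R then f q else 0)"
  by (simp add: restr_def)

lemma restr_in_Gn [simp]: "restr R f \<in> Gn R"
  by (simp add: Gn_def restr_def)

lemma restr_add: "restr R (f + g) = restr R f + restr R g"
  by (simp add: restr_def fun_eq_iff)

lemma restr_zero [simp]: "restr R 0 = 0"
  by (simp add: restr_def fun_eq_iff)

lemma restr_disj: "f \<in> Gn R' \<Longrightarrow> R \<inter> R' = {} \<Longrightarrow> restr R f = 0"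
  by (fastforce simp: restr_def fun_eq_iff Gn_def)

lemma restr_split: "f \<in> Gn Q \<Longrightarrow> R \<subseteq> Q \<Longrightarrow> f = restr R f + restr (Q - R) f"
  by (auto simp: restr_def fun_eq_iff Gn_def)

lemma omega_commute: "omega Q f g = omega Q g f"
  unfolding omega_def by (intro sum.cong refl) (simp only: mult.commute add.commute)

lemma omega_add_left: "omega Q (f + g) h = omega Q f h + omega Q g h"
  unfolding omega_def sum.distrib[symmetric]
  by (intro sum.cong refl) (simp only: plus_fun_apply fst_add snd_add distrib_left distrib_right ac_simps)

lemma omega_add_right: "omega Q h (f + g) = omega Q h f + omega Q h g"
  by (metis omega_add_left omega_commute)

lemma omega_self [simp]: "omega Q f f = 0"
  unfolding omega_def by (intro sum.neutral ballI) (simp only: mult.commute bit_add_self)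

lemma omega_zero [simp]: "omega Q 0 f = 0" "omega Q f 0 = 0"
  by (simp_all add: omega_def)

lemma omega_disj: "f \<in> Gn R \<Longrightarrow> g \<in> Gn R' \<Longrightarrow> R \<inter> R' = {} \<Longrightarrow> omega Q f g = 0"
proof -
  assume *: "f \<in> Gn R" "g \<in> Gn R'" "R \<inter> R' = {}"
  have "f q = 0 \<or> g q = 0" for q
    using * by (cases "q \<in> R") (auto simp: Gn_def)
  thus ?thesis
    unfolding omega_def by (intro sum.neutral ballI) (metis add_0 fst_zero mult_zero_left mult_zero_right snd_zero)
qed

lemma omega_restr_left: "g \<in> Gn R \<Longrightarrow> omega Q (restr R f) g = omega Q f g"
  unfolding omega_def by (rule sum.cong) (auto simp: restr_def Gn_def)

lemma omega_restr_right: "f \<in> Gn R \<Longrightarrow> omega Q f (restr R g) = omega Q f g"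
  by (metis omega_commute omega_restr_left)

lemma omega_subset:
  assumes "finite Q" "R \<subseteq> Q" "g \<in> Gn R"
  shows "omega Q f g = omega R f g"
  unfolding omega_def
  by (rule sum.mono_neutral_right) (use assms in \<open>auto simp: Gn_def\<close>)

definition single :: "'q \<Rightarrow> bit \<times> bit \<Rightarrow> 'q symp" where
  "single q v = (\<lambda>r. if r = q then v else 0)"

lemma single_apply: "single q v r = (if r = q then v else 0)"
  by (simp add: single_def)

lemma single_in_Gn: "q \<in> R \<Longrightarrow> single q v \<in> Gn R"
  by (auto simp: single_def Gn_def)

lemma omega_single:
  assumes "finite Q" "q \<in> Q"
  shows "omega Q (single q v) f = fst v * snd (f q) + snd v * fst (f q)"
proof -
  have "omega Q (single q v) f = (\<Sum>r\<in>{q}. fst (single q v r) * snd (f r) + snd (single q v r) * fst (f r))"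
    unfolding omega_def by (rule sum.mono_neutral_right) (use assms in \<open>auto simp: single_def\<close>)
  thus ?thesis by (simp add: single_def)
qed

text \<open>Nondegeneracy of the form in the style of Riesz. As \<open>omega\<close> pairs X parts
  with Z parts, the representing vector carries at each qubit the values of \<open>l\<close> on Z
  and on X, in this swapped order. Over the field of two elements additivity already is
  linearity.\<close>

lemma functional_omega:
  fixes l :: "'q symp \<Rightarrow> bit"
  assumes fin: "finite Q"
    and add: "\<And>f g. f \<in> Gn Q \<Longrightarrow> g \<in> Gn Q \<Longrightarrow> l (f + g) = l f + l g"
  obtains g where "g \<in> Gn Q" "\<And>f. f \<in> Gn Q \<Longrightarrow> l f = omega Q g f"
proof -
  define g :: "'q symp" where
    "g = (\<lambda>q. if q \<in> Q then (l (single q (0, 1)), l (single q (1, 0))) else 0)"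
  have gQ: "g \<in> Gn Q" by (simp add: g_def Gn_def)
  have l0: "l 0 = 0"
    using add[of 0 0] by simp
  have sing: "l (single q v) = omega Q g (single q v)" if "q \<in> Q" for q v
  proof -
    have "l (single q (1, 1)) = l (single q (1, 0)) + l (single q (0, 1))"
      using add[of "single q (1, 0)" "single q (0, 1)"] that
      by (simp add: single_in_Gn) (simp add: single_def plus_fun_def if_distrib[of "\<lambda>x. x + _"] cong: if_cong)
    moreover have "l (single q (0, 0)) = 0"
      using l0 by (simp add: single_def zero_fun_def flip: zero_prod_def)
    ultimately show ?thesis
      using that by (subst omega_commute, subst omega_single[OF fin that])
        (cases v; cases "fst v"; cases "snd v"; simp add: g_def algebra_simps)
  qed
  have "l f = omega Q g f" if "f \<in> Gn R" "R \<subseteq> Q" for f R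
  proof -
    have "finite R" using that fin finite_subset by auto
    thus ?thesis using that
    proof (induction R arbitrary: f rule: finite_induct)
      case empty
      hence "f = 0" by (auto simp: Gn_def fun_eq_iff)
      thus ?case using l0 omega_zero(2) by metis
    next
      case (insert q R)
      have f: "f = single q (f q) + restr R f"
        using insert by (auto simp: fun_eq_iff single_def restr_def Gn_def)
      have "restr R f \<in> Gn Q" "single q (f q) \<in> Gn Q"
        using insert.prems Gn_mono[of R Q] by (auto intro: single_in_Gn)
      hence "l (single q (f q) + restr R f) = l (single q (f q)) + l (restr R f)"
        by (intro add)
      also have "\<dots> = omega Q g (single q (f q)) + omega Q g (restr R f)"
        using insert.prems by (simp add: sing insert.IH)
      also have "\<dots> = omega Q g (single q (f q) + restr R f)"
        by (simp only: omega_add_right)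
      finally show ?case by (simp only: f[symmetric])
    qed
  qed
  thus ?thesis using gQ that by blast
qed

text \<open>A maximal subspace containing \<open>W\<close> but not \<open>v\<close> has index two, so it is the kernel of a
 linear functional.\<close>

lemma separation:
  assumes fin: "finite Q" and W: "W \<subseteq> Gn Q" "f2subspace W" and v: "v \<in> Gn Q" "v \<notin> W"
  obtains g where "g \<in> Gn Q" "\<And>w. w \<in> W \<Longrightarrow> omega Q g w = 0" "omega Q g v = 1"
proof -
  let ?F = "{M. W \<subseteq> M \<and> M \<subseteq> Gn Q \<and> f2subspace M \<and> v \<notin> M}"
  have "finite ?F"
    by (rule finite_subset[of _ "Pow (Gn Q)"]) (auto simp: finite_Gn fin)
  moreover have "W \<in> ?F" using W v by auto
  ultimately obtain M where M: "M \<in> ?F" and max: "\<And>N. N \<in> ?F \<Longrightarrow> M \<subseteq> N \<Longrightarrow> N = M"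
    by (metis (no_types, lifting) empty_iff finite_has_maximal)
  have M0: "0 \<in> M" and Madd: "\<And>x y. x \<in> M \<Longrightarrow> y \<in> M \<Longrightarrow> x + y \<in> M"
    using M by (auto simp: f2subspace_def)
  \<comment> \<open>By maximality, enlarging \<open>M\<close> by \<open>x\<close> must leave the
    family, and the only condition that can fail is that \<open>v\<close> stays outside; so
    \<open>v\<close> lies in the coset of \<open>x\<close>.\<close>
  have coset: "x + v \<in> M" if x: "x \<in> Gn Q" "x \<notin> M" for x
  proof (rule ccontr)
    assume nv: "x + v \<notin> M"
    let ?N = "M \<union> (\<lambda>m. m + x) ` M"
    have "v \<notin> ?N"
      using M nv by (auto simp: add.commute) (metis add.commute symp_add_self_left)
    moreover have "f2subspace ?N"
      using M0 Madd unfolding f2subspace_def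
      by (auto simp: add.commute add.left_commute image_iff)
    moreover have "?N \<subseteq> Gn Q" using M x(1) by (auto intro!: Gn_add)
    moreover have "W \<subseteq> ?N" using M by blast
    ultimately have "?N \<in> ?F" by blast
    hence "?N = M" using max[of ?N] by blast
    moreover have "x \<in> ?N" using M0 by force
    ultimately show False using x by auto
  qed
  define l :: "'a symp \<Rightarrow> bit" where "l x = (if x \<in> M then 0 else 1)" for x
  have cancel: "y \<in> M" if "x \<in> M" "x + y \<in> M" for x y
    using Madd[OF that] by simp
  have "l (f + g) = l f + l g" if "f \<in> Gn Q" "g \<in> Gn Q" for f g
  proof -
    have "f + g \<in> M" if "f \<notin> M" "g \<notin> M"
    proof -
      have "(f + v) + (g + v) \<in> M"
        using Madd coset that \<open>f \<in> Gn Q\<close> \<open>g \<in> Gn Q\<close> by blast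
      moreover have "(f + v) + (g + v) = f + g"
        by (simp add: add_ac)
      ultimately show ?thesis by simp
    qed
    moreover have "g \<in> M \<longleftrightarrow> f + g \<in> M" if "f \<in> M"
      using cancel[of f g] Madd[of f g] that by blast
    moreover have "f \<in> M \<longleftrightarrow> f + g \<in> M" if "g \<in> M"
      using cancel[of g f] Madd[of f g] that by (auto simp only: add.commute)
    ultimately show ?thesis
      unfolding l_def by (cases "f \<in> M"; cases "g \<in> M") simp_all
  qed
  then obtain g where "g \<in> Gn Q" "\<And>f. f \<in> Gn Q \<Longrightarrow> l f = omega Q g f"
    using functional_omega[OF fin] by metis
  thus ?thesis
    using that[of g] M W v by (metis (no_types, lifting) l_def mem_Collect_eq subsetD)
qed

section \<open>Transvections and the normal form of a hyperbolic pair\<close>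

definition trv :: "'q set \<Rightarrow> 'q symp \<Rightarrow> 'q symp \<Rightarrow> 'q symp" where
  "trv Q h f = (if omega Q f h = 0 then f else f + h)"

text \<open>\<open>fold\<close> applies the head of the list first, so \<open>hs @ ks\<close> is the
  circuit \<open>hs\<close> followed by \<open>ks\<close>; \<open>rots\<close> keeps the same
  order.\<close>

definition trvs :: "'q set \<Rightarrow> 'q symp list \<Rightarrow> 'q symp \<Rightarrow> 'q symp" where
  "trvs Q = fold (trv Q)"

lemma trvs_simps [simp]:
  "trvs Q [] f = f" "trvs Q (h # hs) f = trvs Q hs (trv Q h f)"
  "trvs Q (hs @ ks) f = trvs Q ks (trvs Q hs f)"
  by (simp_all add: trvs_def)

lemma trv_add: "trv Q h (f + g) = trv Q h f + trv Q h g"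
  by (auto simp: trv_def omega_add_left add_ac)

lemma omega_trv: "omega Q (trv Q h f) (trv Q h g) = omega Q f g"
  by (auto simp: trv_def omega_add_left omega_add_right omega_commute[of Q h])

lemma trv_trv [simp]: "trv Q h (trv Q h f) = f"
  by (auto simp: trv_def omega_add_left add_ac)

lemma trvs_add: "trvs Q hs (f + g) = trvs Q hs f + trvs Q hs g"
  by (induction hs arbitrary: f g) (simp_all add: trv_add)

lemma trvs_zero [simp]: "trvs Q hs 0 = 0"
  using trvs_add[of Q hs 0 0] by simp

lemma omega_trvs: "omega Q (trvs Q hs f) (trvs Q hs g) = omega Q f g"
  by (induction hs arbitrary: f g) (simp_all add: omega_trv)

lemma trvs_rev [simp]: "trvs Q (rev hs) (trvs Q hs f) = f"
  by (induction hs arbitrary: f) simp_all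

lemma inj_trvs: "inj (trvs Q hs)"
  by (metis injI trvs_rev)

lemma trv_in_Gn: "h \<in> Gn R \<Longrightarrow> f \<in> Gn R \<Longrightarrow> trv Q h f \<in> Gn R"
  by (simp add: trv_def Gn_add)

lemma trvs_in_Gn: "set hs \<subseteq> Gn R \<Longrightarrow> f \<in> Gn R \<Longrightarrow> trvs Q hs f \<in> Gn R"
  by (induction hs arbitrary: f) (simp_all add: trv_in_Gn)

lemma trvs_fix: "set hs \<subseteq> Gn R \<Longrightarrow> f \<in> Gn R' \<Longrightarrow> R' \<inter> R = {} \<Longrightarrow> trvs Q hs f = f"
  by (induction hs) (auto simp: trv_def omega_disj[of f R' _ R])

text \<open>All vectors of the list live on \<open>R\<close>, so the form sees only the part of
  \<open>f\<close> there. This lets a circuit found on the remaining qubits be read as a circuit on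
  all of them.\<close>

lemma trvs_subset:
  assumes "finite Q" "R \<subseteq> Q" "set hs \<subseteq> Gn R"
  shows "trvs Q hs f = trvs R hs f"
  using assms(3) by (induction hs arbitrary: f) (simp_all add: trv_def omega_subset[OF assms(1,2)])

text \<open>\<open>f\<close> is orthogonal to itself, so it anticommutes with \<open>f + w\<close>
  as well and the difference gets added: non-orthogonal vectors are one transvection apart.
  Orthogonal ones need a vector in between, hence the lists of length two below.\<close>

lemma trv_exchange: "omega Q f w = 1 \<Longrightarrow> trv Q (f + w) f = w"
  by (simp add: trv_def omega_add_right)

text \<open>A circuit takes \<open>f\<close> to X at a qubit where \<open>f\<close> does not vanish.
  The image of \<open>g\<close> still anticommutes with X, and this is what allows it to be moved to
  Z by transvections that fix X.\<close>

lemma hyperbolic_pair_normal_form: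
  assumes fin: "finite Q" and R: "R \<subseteq> Q" and f: "f \<in> Gn R" and g: "g \<in> Gn R"
    and fg: "omega Q f g = 1"
  obtains q hs where "q \<in> R" "set hs \<subseteq> Gn R"
    "trvs Q hs f = single q (1, 0)" "trvs Q hs g = single q (0, 1)"
proof -
  have "f \<noteq> 0" using fg by auto
  then obtain q where q: "f q \<noteq> 0" by (auto simp: fun_eq_iff)
  have qR: "q \<in> R" using f q by (auto simp: Gn_def)
  hence qQ: "q \<in> Q" using R by auto
  let ?X = "single q (1, 0)" and ?Z = "single q (0, 1)"
  \<comment> \<open>\<open>w\<close> must anticommute at \<open>q\<close> both with \<open>f\<close>
    and with X. Z does if \<open>f\<close> has an X part there; otherwise \<open>f q\<close> is Z,
    and Y does.\<close>
  define w where "w = single q (if fst (f q) = 1 then (0, 1) else (1, 1))"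
  have XZ: "omega Q ?X ?Z = 1" by (simp add: omega_single[OF fin qQ] single_apply)
  have fw: "omega Q f w = 1"
    using q by (subst omega_commute) (auto simp: w_def omega_single[OF fin qQ] prod_eq_iff)
  have wX: "omega Q w ?X = 1"
    by (simp add: w_def omega_single[OF fin qQ] single_apply)
  have inR: "w \<in> Gn R" "?X \<in> Gn R" "?Z \<in> Gn R"
    using qR by (simp_all add: w_def single_in_Gn)
  define hs1 where "hs1 = [f + w, w + ?X]"
  have hs1: "set hs1 \<subseteq> Gn R" "trvs Q hs1 f = ?X"
    using f inR by (simp_all add: hs1_def Gn_add trv_exchange fw wX)
  define g' where "g' = trvs Q hs1 g"
  have g': "g' \<in> Gn R" "omega Q ?X g' = 1"
    using trvs_in_Gn[OF hs1(1) g] omega_trvs[of Q hs1 f g] fg by (simp_all add: g'_def hs1)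
  \<comment> \<open>Both \<open>g'\<close> and Z anticommute with X, so X is orthogonal to
    \<open>g' + ?Z\<close> and stays fixed. If \<open>g'\<close> and Z commute, the detour runs
    through \<open>g' + ?X\<close>; the two vectors, X and \<open>g' + ?X + ?Z\<close>, are again
    orthogonal to X. X is written as a sum of source and target so that \<open>trv_exchange\<close>
    applies.\<close>
  define hs2 where "hs2 = (if omega Q g' ?Z = 1 then [g' + ?Z] else [g' + (g' + ?X), (g' + ?X) + ?Z])"
  have "set hs2 \<subseteq> Gn R" using g' inR by (simp add: hs2_def Gn_add)
  moreover have "trvs Q hs2 ?X = ?X"
    using g' XZ by (simp add: hs2_def trv_def omega_add_right)
  moreover have "trvs Q hs2 g' = ?Z"
  proof (cases "omega Q g' ?Z = 1")
    case True
    thus ?thesis by (simp add: hs2_def trv_exchange)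
  next
    case False
    have "omega Q g' (g' + ?X) = 1" "omega Q (g' + ?X) ?Z = 1"
      using g' False XZ by (simp_all add: omega_add_right omega_add_left omega_commute[of Q g' ?X])
    hence "trv Q ((g' + ?X) + ?Z) (trv Q (g' + (g' + ?X)) g') = ?Z"
      by (simp only: trv_exchange)
    thus ?thesis using False by (simp only: hs2_def trvs_simps if_False)
  qed
  ultimately show ?thesis
    using that[of q "hs1 @ hs2"] qR hs1 by (simp add: g'_def)
qed

subsection \<open>Lagrangian subspaces and their block decomposition\<close>

definition lagrangian :: "'q set \<Rightarrow> 'q symp set \<Rightarrow> bool" where
  "lagrangian Q S \<longleftrightarrow> S \<subseteq> Gn Q \<and> f2subspace S \<and> self_dual Q S"

lemma lagrangian_in_Gn: "lagrangian Q S \<Longrightarrow> f \<in> S \<Longrightarrow> f \<in> Gn Q"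
  by (auto simp: lagrangian_def)

lemma lagrangian_zero: "lagrangian Q S \<Longrightarrow> 0 \<in> S"
  by (simp add: lagrangian_def f2subspace_def)

lemma lagrangian_add: "lagrangian Q S \<Longrightarrow> f \<in> S \<Longrightarrow> g \<in> S \<Longrightarrow> f + g \<in> S"
  by (simp add: lagrangian_def f2subspace_def)

lemma lagrangian_omega: "lagrangian Q S \<Longrightarrow> f \<in> S \<Longrightarrow> g \<in> S \<Longrightarrow> omega Q f g = 0"
  unfolding lagrangian_def self_dual_def by blast

lemma lagrangian_memI:
  "lagrangian Q S \<Longrightarrow> f \<in> Gn Q \<Longrightarrow> (\<And>g. g \<in> S \<Longrightarrow> omega Q f g = 0) \<Longrightarrow> f \<in> S"
  unfolding lagrangian_def self_dual_def by blast

lemma lagrangianI: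
  assumes "S \<subseteq> Gn Q" "f2subspace S"
    and "\<And>f g. f \<in> S \<Longrightarrow> g \<in> S \<Longrightarrow> omega Q f g = 0"
    and "\<And>f. f \<in> Gn Q \<Longrightarrow> (\<And>g. g \<in> S \<Longrightarrow> omega Q f g = 0) \<Longrightarrow> f \<in> S"
  shows "lagrangian Q S"
  using assms unfolding lagrangian_def self_dual_def by blast

lemma f2subspace_trvs_image: "f2subspace S \<Longrightarrow> f2subspace (trvs Q hs ` S)"
  unfolding f2subspace_def
  by (auto simp: image_iff simp flip: trvs_add) (metis trvs_zero)

lemma lagrangian_trvs:
  assumes S: "lagrangian Q S" and hs: "set hs \<subseteq> Gn Q"
  shows "lagrangian Q (trvs Q hs ` S)"
proof (rule lagrangianI)
  show "trvs Q hs ` S \<subseteq> Gn Q"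
    using S hs by (auto intro: trvs_in_Gn lagrangian_in_Gn)
  show "f2subspace (trvs Q hs ` S)"
    using S by (simp add: f2subspace_trvs_image lagrangian_def)
  show "omega Q f g = 0" if "f \<in> trvs Q hs ` S" "g \<in> trvs Q hs ` S" for f g
    using that lagrangian_omega[OF S] by (auto simp: omega_trvs)
  fix f assume f: "f \<in> Gn Q" "\<And>g. g \<in> trvs Q hs ` S \<Longrightarrow> omega Q f g = 0"
  have ff: "f = trvs Q hs (trvs Q (rev hs) f)"
    using trvs_rev[of Q "rev hs" f] by simp
  have "trvs Q (rev hs) f \<in> S"
  proof (rule lagrangian_memI[OF S])
    show "trvs Q (rev hs) f \<in> Gn Q" using f hs by (simp add: trvs_in_Gn)
    fix g assume "g \<in> S"
    hence "omega Q (trvs Q hs (trvs Q (rev hs) f)) (trvs Q hs g) = 0"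
      using f(2)[of "trvs Q hs g"] ff by simp
    thus "omega Q (trvs Q (rev hs) f) g = 0" by (simp only: omega_trvs)
  qed
  thus "f \<in> trvs Q hs ` S" using ff by blast
qed

text \<open>The stabilizer group, without signs, of the product of block states: on each block X
  occurs everywhere or nowhere, and the Z part has even weight. One formula serves EPR pairs and GHZ
  triples.\<close>

definition ghz_group :: "'q set set \<Rightarrow> 'q symp set" where
  "ghz_group P = {f \<in> Gn (\<Union>P). \<forall>blk\<in>P.
     (\<forall>q\<in>blk. \<forall>r\<in>blk. fst (f q) = fst (f r)) \<and> (\<Sum>q\<in>blk. snd (f q)) = 0}"

lemma ghz_group_in_Gn: "f \<in> ghz_group P \<Longrightarrow> f \<in> Gn (\<Union>P)"
  by (simp add: ghz_group_def)

lemma ghz_group_fst: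
  "f \<in> ghz_group P \<Longrightarrow> blk \<in> P \<Longrightarrow> q \<in> blk \<Longrightarrow> r \<in> blk \<Longrightarrow> fst (f q) = fst (f r)"
  unfolding ghz_group_def mem_Collect_eq
  by (elim conjE) (drule (1) bspec, elim conjE, drule (1) bspec, erule (1) bspec)

lemma ghz_group_snd: "f \<in> ghz_group P \<Longrightarrow> blk \<in> P \<Longrightarrow> (\<Sum>q\<in>blk. snd (f q)) = 0"
  unfolding ghz_group_def mem_Collect_eq by (elim conjE) (drule (1) bspec, elim conjE)

lemma ghz_groupI:
  assumes "f \<in> Gn (\<Union>P)"
    and "\<And>blk q r. blk \<in> P \<Longrightarrow> q \<in> blk \<Longrightarrow> r \<in> blk \<Longrightarrow> fst (f q) = fst (f r)"
    and "\<And>blk. blk \<in> P \<Longrightarrow> (\<Sum>q\<in>blk. snd (f q)) = 0"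
  shows "f \<in> ghz_group P"
  unfolding ghz_group_def mem_Collect_eq by (intro conjI ballI assms)

lemma ghz_group_insert:
  assumes "blk \<inter> \<Union>P = {}"
  shows "ghz_group (insert blk P) = {t + s | t s. t \<in> ghz_group {blk} \<and> s \<in> ghz_group P}"
proof (intro set_eqI iffI)
  fix f assume f: "f \<in> ghz_group (insert blk P)"
  have "f = restr blk f + restr (\<Union>P) f"
    using f assms by (auto simp: ghz_group_def Gn_def restr_def fun_eq_iff)
  moreover have "restr blk f \<in> ghz_group {blk}"
  proof -
    have "(\<Sum>q\<in>blk. snd (restr blk f q)) = (\<Sum>q\<in>blk. snd (f q))"
      by (intro sum.cong) (auto simp: restr_apply)
    moreover have "fst (restr blk f q) = fst (restr blk f r)" if "q \<in> blk" "r \<in> blk" for q r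
      using ghz_group_fst[OF f _ that] that by (simp add: restr_apply)
    moreover have "(\<Sum>q\<in>blk. snd (f q)) = 0" using ghz_group_snd[OF f] by simp
    ultimately show ?thesis
      by (intro ghz_groupI) (simp, metis singletonD, metis singletonD)
  qed
  moreover have "restr (\<Union>P) f \<in> ghz_group P"
  proof -
    have "(\<Sum>q\<in>b. snd (restr (\<Union>P) f q)) = 0" if "b \<in> P" for b
    proof -
      have "(\<Sum>q\<in>b. snd (restr (\<Union>P) f q)) = (\<Sum>q\<in>b. snd (f q))"
        using that by (intro sum.cong) (auto simp: restr_apply)
      thus ?thesis using ghz_group_snd[OF f] that by simp
    qed
    moreover have "fst (restr (\<Union>P) f q) = fst (restr (\<Union>P) f r)" if "b \<in> P" "q \<in> b" "r \<in> b" for b q r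
      using ghz_group_fst[OF f _ that(2,3)] that by (auto simp: restr_apply)
    ultimately show ?thesis by (intro ghz_groupI restr_in_Gn)
  qed
  ultimately show "f \<in> {t + s | t s. t \<in> ghz_group {blk} \<and> s \<in> ghz_group P}" by blast
next
  fix f assume "f \<in> {t + s | t s. t \<in> ghz_group {blk} \<and> s \<in> ghz_group P}"
  then obtain t s where f: "f = t + s" and t: "t \<in> ghz_group {blk}" and s: "s \<in> ghz_group P" by auto
  have t0: "t q = 0" if "q \<in> \<Union>P" for q
    by (rule GnD[OF ghz_group_in_Gn[OF t]]) (use that assms in auto)
  have s0: "s q = 0" if "q \<in> blk" for q
    by (rule GnD[OF ghz_group_in_Gn[OF s]]) (use that assms in auto)
  have ft: "f q = t q" if "q \<in> blk" for q
    using s0[OF that] by (simp add: f)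
  have fs: "f q = s q" if "b \<in> P" "q \<in> b" for q b
    using t0[of q] that by (auto simp: f)
  have "(\<Sum>q\<in>blk. snd (f q)) = 0" "\<And>b. b \<in> P \<Longrightarrow> (\<Sum>q\<in>b. snd (f q)) = 0"
    using ghz_group_snd[OF t, of blk] ghz_group_snd[OF s] by (simp_all add: ft fs)
  moreover have "\<And>q r. q \<in> blk \<Longrightarrow> r \<in> blk \<Longrightarrow> fst (f q) = fst (f r)"
    using ghz_group_fst[OF t, of blk] ft by (metis singletonI)
  moreover have "\<And>b q r. b \<in> P \<Longrightarrow> q \<in> b \<Longrightarrow> r \<in> b \<Longrightarrow> fst (f q) = fst (f r)"
    using ghz_group_fst[OF s] fs by metis
  moreover have "f \<in> Gn (\<Union>(insert blk P))"
    using ghz_group_in_Gn[OF t] ghz_group_in_Gn[OF s] by (auto simp: f Gn_def)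
  ultimately show "f \<in> ghz_group (insert blk P)"
    by (intro ghz_groupI) (simp, metis insertE, metis insertE)
qed

text \<open>The block group is its own orthogonal complement on the block. An element of
  \<open>S\<close> commutes with all of it, so its part on the block belongs to the block group,
  hence to \<open>S\<close>, and can be subtracted; what remains is self-dual on the other
  qubits.\<close>

lemma
  assumes fin: "finite Q" and S: "lagrangian Q S" and blk: "blk \<subseteq> Q" "ghz_group {blk} \<subseteq> S"
  shows lagrangian_peel_restr_block: "f \<in> S \<Longrightarrow> restr blk f \<in> ghz_group {blk}"
    and lagrangian_peel_restr_rest: "f \<in> S \<Longrightarrow> restr (Q - blk) f \<in> S \<inter> Gn (Q - blk)"
    and lagrangian_peel: "lagrangian (Q - blk) (S \<inter> Gn (Q - blk))"
proof -
  have finb: "finite blk" using fin blk(1) finite_subset by blast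
  show 1: "restr blk f \<in> ghz_group {blk}" if f: "f \<in> S" for f
  proof -
    have "fst (f q) = fst (f r)" if "q \<in> blk" "r \<in> blk" "q \<noteq> r" for q r
    proof -
      \<comment> \<open>Commuting with Z on both \<open>q\<close> and \<open>r\<close> compares the
        X parts at these qubits.\<close>
      let ?t = "single q (0, 1) + single r (0, 1)"
      have "(\<Sum>p\<in>blk. snd (?t p)) = (\<Sum>p\<in>blk. if p = q then 1 else 0) + (\<Sum>p\<in>blk. if p = r then 1 else 0)"
        unfolding sum.distrib[symmetric] by (intro sum.cong) (auto simp: single_def)
      also have "\<dots> = 0" using that finb by simp
      finally have "?t \<in> ghz_group {blk}"
        using that by (auto simp: ghz_group_def single_apply intro!: Gn_add single_in_Gn)
      hence "omega Q ?t f = 0" using lagrangian_omega[OF S] blk(2) f by blast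
      moreover have "q \<in> Q" "r \<in> Q" using that blk(1) by auto
      ultimately show ?thesis
        by (cases "fst (f q)"; cases "fst (f r)"; simp add: omega_add_left omega_single[OF fin])
    qed
    moreover have "(\<Sum>q\<in>blk. snd (f q)) = 0"
    proof -
      \<comment> \<open>Commuting with X on the whole block yields the parity of the Z
        parts.\<close>
      let ?t = "restr blk (\<lambda>_. (1, 0))"
      have "?t \<in> ghz_group {blk}"
        by (auto simp: ghz_group_def restr_apply intro!: sum.neutral)
      hence "omega Q ?t f = 0" using lagrangian_omega[OF S] blk(2) f by blast
      moreover have "omega Q ?t f = (\<Sum>q\<in>blk. fst (?t q) * snd (f q) + snd (?t q) * fst (f q))"
        unfolding omega_def by (rule sum.mono_neutral_right) (use fin blk in \<open>auto simp: restr_apply\<close>)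
      moreover have "\<dots> = (\<Sum>q\<in>blk. snd (f q))"
        by (intro sum.cong) (auto simp: restr_apply)
      ultimately show ?thesis by simp
    qed
    moreover have "(\<Sum>q\<in>blk. snd (restr blk f q)) = (\<Sum>q\<in>blk. snd (f q))"
      by (intro sum.cong) (auto simp: restr_apply)
    moreover have "fst (restr blk f q) = fst (restr blk f r)" if "q \<in> blk" "r \<in> blk" for q r
      using calculation(1)[OF that] that by (auto simp: restr_apply)
    ultimately show ?thesis
      by (intro ghz_groupI) (simp, metis singletonD, metis singletonD)
  qed
  show 2: "restr (Q - blk) f \<in> S \<inter> Gn (Q - blk)" if f: "f \<in> S" for f
  proof -
    have "restr (Q - blk) f = f + restr blk f"
      using restr_split[OF lagrangian_in_Gn[OF S f] blk(1)]
      by (metis add.commute symp_add_self_left)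
    hence "restr (Q - blk) f \<in> S" using lagrangian_add[OF S f] 1[OF f] blk(2) by auto
    thus ?thesis by simp
  qed
  have om: "omega Q f g = omega (Q - blk) f g" if "g \<in> Gn (Q - blk)" for f g
    using omega_subset[OF fin _ that] by simp
  show "lagrangian (Q - blk) (S \<inter> Gn (Q - blk))"
  proof (rule lagrangianI)
    show "f2subspace (S \<inter> Gn (Q - blk))"
      using S by (auto simp: f2subspace_def lagrangian_def Gn_add)
    show "omega (Q - blk) f g = 0" if "f \<in> S \<inter> Gn (Q - blk)" "g \<in> S \<inter> Gn (Q - blk)" for f g
      using that lagrangian_omega[OF S] om by (metis IntE)
    fix f assume f: "f \<in> Gn (Q - blk)" "\<And>g. g \<in> S \<inter> Gn (Q - blk) \<Longrightarrow> omega (Q - blk) f g = 0"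
    \<comment> \<open>Since \<open>f\<close> vanishes on the block, pairing it with some
      \<open>g\<close> in \<open>S\<close> is pairing it with the part of \<open>g\<close> off the
      block, which lies in \<open>S\<close> by the second claim.\<close>
    have "f \<in> S"
    proof (rule lagrangian_memI[OF S])
      show "f \<in> Gn Q" using f(1) Gn_mono[of "Q - blk" Q] by auto
      show "omega Q f g = 0" if "g \<in> S" for g
        using f(2)[OF 2[OF that]] omega_restr_right[OF f(1), of Q g] om[of "restr (Q - blk) g" f]
        by simp
    qed
    thus "f \<in> S \<inter> Gn (Q - blk)" using f by simp
  qed auto
qed

text \<open>On two qubits even Z parity means equal Z parts, so both qubits carry the same
  Pauli.\<close>

lemma ghz_group_pair:
  assumes "q \<noteq> r"
  shows "ghz_group {{q, r}} = range (\<lambda>v. single q v + single r v)"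
proof (intro set_eqI iffI)
  fix t assume t: "t \<in> ghz_group {{q, r}}"
  have sum0: "(\<Sum>p\<in>{q, r}. snd (t p)) = 0" and fst_eq: "fst (t q) = fst (t r)"
    using ghz_group_snd[OF t, of "{q, r}"] ghz_group_fst[OF t, of "{q, r}" q r] by simp_all
  have "(\<Sum>p\<in>{q, r}. snd (t p)) = snd (t q) + snd (t r)"
    using assms by simp
  with sum0 have sum0': "snd (t q) + snd (t r) = 0" by metis
  have "snd (t r) = snd (t q)"
    using sum0' by (metis add.right_neutral bit_add_self_left)
  with fst_eq have "t r = t q" by (metis prod.expand)
  hence "t = single q (t q) + single r (t q)"
    using ghz_group_in_Gn[OF t] assms by (auto simp: Gn_def single_def fun_eq_iff)
  thus "t \<in> range (\<lambda>v. single q v + single r v)" by blast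
next
  fix t assume "t \<in> range (\<lambda>v. single q v + single r v)"
  then obtain v where t: "t = single q v + single r v" by blast
  have tq: "t q = v" "t r = v" using assms by (auto simp: t single_def)
  show "t \<in> ghz_group {{q, r}}"
  proof (rule ghz_groupI)
    show "t \<in> Gn (\<Union>{{q, r}})" by (auto simp: t intro!: Gn_add single_in_Gn)
  qed (use tq assms in auto)
qed

text \<open>\<open>a\<close>, \<open>b\<close> and \<open>c\<close> are the exponents of the
  generators XXX, ZZI and ZIZ.\<close>

definition triple_vec :: "'q \<Rightarrow> 'q \<Rightarrow> 'q \<Rightarrow> bit \<Rightarrow> bit \<Rightarrow> bit \<Rightarrow> 'q symp" where
  "triple_vec q r s a b c = single q (a, b + c) + (single r (a, b) + single s (a, c))"

lemma ghz_group_triple: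
  assumes "distinct [q, r, s]"
  shows "ghz_group {{q, r, s}} = {triple_vec q r s a b c | a b c. True}"
proof (intro set_eqI iffI)
  fix t assume t: "t \<in> ghz_group {{q, r, s}}"
  have sum0: "(\<Sum>p\<in>{q, r, s}. snd (t p)) = 0"
    and fst_eq: "fst (t q) = fst (t r)" "fst (t q) = fst (t s)"
    using ghz_group_snd[OF t, of "{q, r, s}"] ghz_group_fst[OF t, of "{q, r, s}" q]
    by (simp_all del: sum.insert sum.insert_if)
  have "(\<Sum>p\<in>{q, r, s}. snd (t p)) = snd (t q) + (snd (t r) + snd (t s))"
    using assms(1) by simp
  with sum0 have sum0': "snd (t q) + (snd (t r) + snd (t s)) = 0" by metis
  have "snd (t q) = snd (t r) + snd (t s)"
    using sum0' by (metis add.right_neutral bit_add_self_left)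
  with fst_eq have "t q = (fst (t q), snd (t r) + snd (t s))" "t r = (fst (t q), snd (t r))"
    "t s = (fst (t q), snd (t s))"
    by (metis prod.collapse)+
  moreover have "t = single q (t q) + (single r (t r) + single s (t s))"
    using ghz_group_in_Gn[OF t] assms(1) by (auto simp: Gn_def single_def fun_eq_iff)
  ultimately have "t = triple_vec q r s (fst (t q)) (snd (t r)) (snd (t s))"
    unfolding triple_vec_def by metis
  thus "t \<in> {triple_vec q r s a b c | a b c. True}" by blast
next
  fix t assume "t \<in> {triple_vec q r s a b c | a b c. True}"
  then obtain a b c where t: "t = triple_vec q r s a b c" by blast
  have tq: "t q = (a, b + c)" "t r = (a, b)" "t s = (a, c)"
    using assms by (auto simp: t triple_vec_def single_def)
  show "t \<in> ghz_group {{q, r, s}}"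
  proof (rule ghz_groupI)
    show "t \<in> Gn (\<Union>{{q, r, s}})"
      by (auto simp: t triple_vec_def intro!: Gn_add single_in_Gn)
    show "(\<Sum>p\<in>blk. snd (t p)) = 0" if "blk \<in> {{q, r, s}}" for blk
      using that assms tq by (cases b; cases c; simp)
  qed (use tq in auto)
qed

lemma ghz_group_pair_subset:
  assumes "q \<noteq> r" and M: "f2subspace M"
    and X: "single q (1, 0) + single r (1, 0) \<in> M" and Z: "single q (0, 1) + single r (0, 1) \<in> M"
  shows "ghz_group {{q, r}} \<subseteq> M"
proof -
  have s0: "single p (0, 0) = 0" for p :: 'a
    by (simp add: single_def zero_fun_def flip: zero_prod_def)
  have s: "single p (1, 1) = single p (1, 0) + single p (0, 1)" for p :: 'a
    by (simp add: single_def fun_eq_iff)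
  have "(single q (1, 0) + single r (1, 0)) + (single q (0, 1) + single r (0, 1)) \<in> M" "0 \<in> M"
    using M X Z unfolding f2subspace_def by blast+
  hence "single q (a, b) + single r (a, b) \<in> M" for a b
    using X Z by (cases a; cases b; simp add: s0 s add_ac)
  thus ?thesis unfolding ghz_group_pair[OF assms(1)] by auto
qed

lemma ghz_group_triple_subset:
  assumes "distinct [q, r, s]" and M: "f2subspace M"
    and X: "single q (1, 0) + (single r (1, 0) + single s (1, 0)) \<in> M"
    and Z: "single q (0, 1) + single r (0, 1) \<in> M" "single q (0, 1) + single s (0, 1) \<in> M"
  shows "ghz_group {{q, r, s}} \<subseteq> M"
proof -
  have s0: "single p (0, 0) = 0" for p :: 'a
    by (simp add: single_def zero_fun_def flip: zero_prod_def)
  have s: "single p (1, 1) = single p (1, 0) + single p (0, 1)" for p :: 'a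
    by (simp add: single_def fun_eq_iff)
  have "0 \<in> M" and add: "\<And>f g. f \<in> M \<Longrightarrow> g \<in> M \<Longrightarrow> f + g \<in> M"
    using M unfolding f2subspace_def by blast+
  moreover note X Z add[OF X Z(1)] add[OF X Z(2)] add[OF Z] add[OF X add[OF Z]]
  ultimately have "single q (a, b + c) + (single r (a, b) + single s (a, c)) \<in> M" for a b c
    by (cases a; cases b; cases c; simp add: s0 s add_ac)
  thus ?thesis unfolding ghz_group_triple[OF assms(1)] triple_vec_def by blast
qed

section \<open>Party-local circuits and the extraction of blocks\<close>

definition party_local :: "'q set \<Rightarrow> ('q \<Rightarrow> party) \<Rightarrow> 'q symp \<Rightarrow> bool" where
  "party_local Q pty h \<longleftrightarrow> (\<exists>\<alpha>. h \<in> Gn (qubits_of Q pty \<alpha>))"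

lemma qubits_of_subset: "qubits_of Q pty \<alpha> \<subseteq> Q"
  by (auto simp: qubits_of_def)

lemma qubits_of_disj: "\<alpha> \<noteq> \<beta> \<Longrightarrow> qubits_of Q pty \<alpha> \<inter> qubits_of Q pty \<beta> = {}"
  by (auto simp: qubits_of_def)

lemma party_local_in_Gn: "\<forall>h\<in>set hs. party_local Q pty h \<Longrightarrow> set hs \<subseteq> Gn Q"
  using Gn_mono[OF qubits_of_subset] by (fastforce simp: party_local_def)

text \<open>A transvection along a vector of another party does not touch \<alpha>. Along a vector
  of \<alpha> it leaves \<open>f\<close> alone, because \<open>f\<close> vanishes on \<alpha> and is
  therefore orthogonal to that vector.\<close>

lemma restr_trv_party:
  assumes "party_local Q pty h" "restr (qubits_of Q pty \<alpha>) f = 0"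
  shows "restr (qubits_of Q pty \<alpha>) (trv Q h f) = 0"
proof -
  obtain \<beta> where h: "h \<in> Gn (qubits_of Q pty \<beta>)"
    using assms by (auto simp: party_local_def)
  show ?thesis
  proof (cases "\<alpha> = \<beta>")
    case True
    hence "omega Q f h = 0"
      using omega_restr_left[OF h, of Q f] assms by simp
    thus ?thesis using assms by (simp add: trv_def)
  next
    case False
    thus ?thesis
      using assms restr_disj[OF h qubits_of_disj[OF False]] by (simp add: trv_def restr_add)
  qed
qed

text \<open>The converse is the forward direction for the reversed list. This equivalence carries
  local and co-local subgroups through a circuit.\<close>

lemma restr_trvs_party:
  assumes "\<forall>h\<in>set hs. party_local Q pty h"
  shows "restr (qubits_of Q pty \<alpha>) (trvs Q hs f) = 0 \<longleftrightarrow> restr (qubits_of Q pty \<alpha>) f = 0"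
proof -
  have *: "restr (qubits_of Q pty \<alpha>) (trvs Q hs f) = 0"
    if "\<forall>h\<in>set hs. party_local Q pty h" "restr (qubits_of Q pty \<alpha>) f = 0" for hs f
    using that by (induction hs arbitrary: f) (simp_all add: restr_trv_party)
  show ?thesis
    using *[OF assms, of f] *[of "rev hs" "trvs Q hs f"] assms by auto
qed

lemma restr_eq_0_iff: "restr R f = 0 \<longleftrightarrow> (\<forall>q\<in>R. f q = 0)"
  by (auto simp: restr_def fun_eq_iff)

lemma colocal_sub_restr: "colocal_sub Q pty S \<alpha> = {g \<in> S. restr (qubits_of Q pty \<alpha>) g = 0}"
  by (auto simp: colocal_sub_def restr_eq_0_iff qubits_of_def)

lemma local_sub_restr:
  "local_sub Q pty S \<alpha> = {g \<in> S. \<forall>\<beta>. \<beta> \<noteq> \<alpha> \<longrightarrow> restr (qubits_of Q pty \<beta>) g = 0}"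
  by (auto simp: local_sub_def restr_eq_0_iff qubits_of_def)

lemma colocal_sub_trvs:
  "\<forall>h\<in>set hs. party_local Q pty h \<Longrightarrow>
    colocal_sub Q pty (trvs Q hs ` S) \<alpha> = trvs Q hs ` colocal_sub Q pty S \<alpha>"
  by (auto simp: colocal_sub_restr restr_trvs_party)

lemma local_sub_trvs:
  "\<forall>h\<in>set hs. party_local Q pty h \<Longrightarrow>
    local_sub Q pty (trvs Q hs ` S) \<alpha> = trvs Q hs ` local_sub Q pty S \<alpha>"
  by (auto simp: local_sub_restr restr_trvs_party)

lemma S_loc_trvs:
  assumes "\<forall>h\<in>set hs. party_local Q pty h"
  shows "S_loc Q pty (trvs Q hs ` S) = trvs Q hs ` S_loc Q pty S"
  unfolding S_loc_def colocal_sub_trvs[OF assms]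
  by (auto simp: image_iff trvs_add) (metis trvs_add)+

lemma full_local_ranks_trvs:
  "\<forall>h\<in>set hs. party_local Q pty h \<Longrightarrow> full_local_ranks Q pty S \<Longrightarrow>
    full_local_ranks Q pty (trvs Q hs ` S)"
  by (simp add: full_local_ranks_def local_sub_trvs)

text \<open>Circuits of different parties act on disjoint qubits and fix each other's vectors, so
  the pairs can be normalized one party at a time. Splitting off an EPR pair involves two parties, a
  GHZ state three.\<close>

lemma hyperbolic_pairs_normal_form:
  assumes fin: "finite Q" "finite J"
    and "\<And>\<alpha>. \<alpha> \<in> J \<Longrightarrow> F \<alpha> \<in> Gn (qubits_of Q pty \<alpha>)"
    and "\<And>\<alpha>. \<alpha> \<in> J \<Longrightarrow> G \<alpha> \<in> Gn (qubits_of Q pty \<alpha>)"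
    and "\<And>\<alpha>. \<alpha> \<in> J \<Longrightarrow> omega Q (F \<alpha>) (G \<alpha>) = 1"
  shows "\<exists>hs q. (\<forall>h\<in>set hs. \<exists>\<alpha>\<in>J. h \<in> Gn (qubits_of Q pty \<alpha>)) \<and>
    (\<forall>\<alpha>\<in>J. q \<alpha> \<in> qubits_of Q pty \<alpha> \<and> trvs Q hs (F \<alpha>) = single (q \<alpha>) (1, 0) \<and>
      trvs Q hs (G \<alpha>) = single (q \<alpha>) (0, 1))"
  using fin(2) assms(3-)
proof (induction J rule: finite_induct)
  case empty
  show ?case by (rule exI[of _ "[]"]) simp
next
  case (insert \<alpha> J)
  let ?R = "qubits_of Q pty"
  obtain hs q where hs: "\<forall>h\<in>set hs. \<exists>\<beta>\<in>J. h \<in> Gn (?R \<beta>)"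
    and q: "\<And>\<beta>. \<beta> \<in> J \<Longrightarrow> q \<beta> \<in> ?R \<beta> \<and> trvs Q hs (F \<beta>) = single (q \<beta>) (1, 0) \<and>
      trvs Q hs (G \<beta>) = single (q \<beta>) (0, 1)"
    using insert.IH insert.prems by (metis insertI2)
  obtain r ks where r: "r \<in> ?R \<alpha>" and ks: "set ks \<subseteq> Gn (?R \<alpha>)"
    "trvs Q ks (F \<alpha>) = single r (1, 0)" "trvs Q ks (G \<alpha>) = single r (0, 1)"
    using hyperbolic_pair_normal_form[OF fin(1) qubits_of_subset] insert.prems by (metis insertI1)
  have hsJ: "set hs \<subseteq> Gn (\<Union>(?R ` J))"
    using hs Gn_mono[of _ "\<Union>(?R ` J)"] by blast
  have disj: "?R \<alpha> \<inter> \<Union>(?R ` J) = {}"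
    using \<open>\<alpha> \<notin> J\<close> by (auto simp: qubits_of_def)
  have fix1: "trvs Q hs (F \<alpha>) = F \<alpha>" "trvs Q hs (G \<alpha>) = G \<alpha>"
    using trvs_fix[OF hsJ _ disj] insert.prems by blast+
  have fix2: "trvs Q ks (single (q \<beta>) v) = single (q \<beta>) v" if "\<beta> \<in> J" for \<beta> v
    using trvs_fix[OF ks(1), of _ "?R \<beta>"] q[OF that] qubits_of_disj[of \<beta> \<alpha> Q pty] that \<open>\<alpha> \<notin> J\<close>
    by (metis single_in_Gn)
  show ?case
    by (rule exI[of _ "hs @ ks"], rule exI[of _ "q(\<alpha> := r)"])
      (use hs q r ks fix1 fix2 \<open>\<alpha> \<notin> J\<close> in auto)
qed

text \<open>The orthogonal complement of \<open>S \<inter> Gn (A \<union> B)\<close> is \<open>S + Gn C\<close>.\<close>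

lemma lagrangian_extend:
  assumes fin: "finite Q" and S: "lagrangian Q S" and Q: "Q = A \<union> B \<union> C"
    and v: "v \<in> Gn A" and orth: "\<And>s. s \<in> S \<Longrightarrow> s \<in> Gn (A \<union> B) \<Longrightarrow> omega Q v s = 0"
  obtains c where "c \<in> Gn C" "v + c \<in> S"
proof -
  let ?W = "{s + c | s c. s \<in> S \<and> c \<in> Gn C}"
  have "?W \<subseteq> Gn Q"
    using lagrangian_in_Gn[OF S] Gn_mono[of C Q] Q by (auto intro!: Gn_add)
  moreover have "f2subspace ?W"
    unfolding f2subspace_def
  proof (intro conjI ballI)
    show "0 \<in> ?W" using lagrangian_zero[OF S] Gn_zero[of C]
      by (metis (mono_tags, lifting) add.right_neutral mem_Collect_eq)
    fix f g assume "f \<in> ?W" "g \<in> ?W"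
    then obtain s c s' c' where "f = s + c" "g = s' + c'" "s \<in> S" "s' \<in> S" "c \<in> Gn C" "c' \<in> Gn C"
      by auto
    moreover from this have "f + g = (s + s') + (c + c')" by (simp add: add_ac)
    ultimately show "f + g \<in> ?W" using lagrangian_add[OF S] Gn_add by blast
  qed
  moreover have "v \<in> Gn Q" using v Gn_mono[of A Q] Q by auto
  \<comment> \<open>A separating \<open>g\<close> is orthogonal to \<open>S\<close>, hence in
    \<open>S\<close>, and orthogonal to all of \<open>Gn C\<close>, hence zero on \<open>C\<close>;
    but elements of this kind are orthogonal to \<open>v\<close> by assumption.\<close>
  moreover have False if "g \<in> Gn Q" and g: "\<And>w. w \<in> ?W \<Longrightarrow> omega Q g w = 0" "omega Q g v = 1" for g
  proof -
    have "omega Q g s = 0" if "s \<in> S" for s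
      using g(1)[of s] that by (metis (mono_tags, lifting) Gn_zero add.right_neutral mem_Collect_eq)
    hence "g \<in> S" using lagrangian_memI[OF S \<open>g \<in> Gn Q\<close>] by blast
    have gc: "omega Q c g = 0" if "c \<in> Gn C" for c
      using g(1)[of c] that lagrangian_zero[OF S]
      by (metis (mono_tags, lifting) add.left_neutral mem_Collect_eq omega_commute)
    have "g q = 0" if "q \<in> C" for q
    proof -
      have "q \<in> Q" using that Q by auto
      thus ?thesis
        using gc[of "single q (1, 0)"] gc[of "single q (0, 1)"] that
        by (simp add: single_in_Gn omega_single[OF fin] prod_eq_iff)
    qed
    hence "g \<in> Gn (A \<union> B)" using \<open>g \<in> Gn Q\<close> Q by (auto simp: Gn_def)
    thus False using orth[OF \<open>g \<in> S\<close>] g(2) by (simp add: omega_commute)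
  qed
  ultimately have "v \<in> ?W" using separation[OF fin, of ?W v] by blast
  then obtain s c where "v = s + c" "s \<in> S" "c \<in> Gn C" by auto
  moreover from this have "v + c = s" by (metis add.commute symp_add_self_left)
  ultimately show ?thesis using that by metis
qed

lemma Un_qubits_of_two_parties:
  "\<alpha> \<noteq> \<beta> \<Longrightarrow> f \<in> Gn (qubits_of Q pty \<alpha> \<union> qubits_of Q pty \<beta>) \<Longrightarrow>
    f = restr (qubits_of Q pty \<alpha>) f + restr (qubits_of Q pty \<beta>) f"
  by (auto simp: Gn_def restr_def fun_eq_iff qubits_of_def)

text \<open>Full local ranks give the two properties of \<open>z\<^sub>\<alpha>\<close> on which the
  GHZ case rests: it is nonzero, since otherwise \<open>z\<close> would belong to \<beta> alone, and
  it is not in \<open>S\<close>, so that self-duality supplies an anticommuting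
  \<open>f\<close>.\<close>

lemma extract_block:
  assumes fin: "finite Q" and ne: "Q \<noteq> {}" and S: "lagrangian Q S" and flr: "full_local_ranks Q pty S"
  obtains hs blk where "\<forall>h\<in>set hs. party_local Q pty h" "blk \<subseteq> Q" "inj_on pty blk" "card blk \<ge> 2"
    "ghz_group {blk} \<subseteq> trvs Q hs ` S"
proof -
  let ?R = "qubits_of Q pty"
  have parties: "\<exists>\<gamma>. \<gamma> \<noteq> \<alpha> \<and> \<gamma> \<noteq> \<beta> \<and> UNIV = {\<alpha>, \<beta>, \<gamma>}" if "\<alpha> \<noteq> \<beta>" for \<alpha> \<beta> :: party
  proof -
    show ?thesis
      unfolding UNIV_party using that by (cases \<alpha>; cases \<beta>; simp; blast)
  qed
  have Q: "Q = ?R \<alpha> \<union> ?R \<beta> \<union> ?R \<gamma>" if "UNIV = {\<alpha>, \<beta>, \<gamma>}" for \<alpha> \<beta> \<gamma>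
    using that by (auto simp: qubits_of_def)
  have sub: "f2subspace (trvs Q hs ` S)" for hs
    using S by (simp add: f2subspace_trvs_image lagrangian_def)
  have no_local: "g = 0" if "g \<in> S" "g \<in> Gn (?R \<alpha>)" for g \<alpha>
  proof -
    have "g \<in> local_sub Q pty S \<alpha>"
      using that by (auto simp: local_sub_def Gn_def qubits_of_def)
    thus ?thesis using flr by (simp add: full_local_ranks_def)
  qed
  show thesis
  proof (cases "\<exists>\<alpha> \<beta> f g. \<alpha> \<noteq> \<beta> \<and> f \<in> S \<and> g \<in> S \<and> f \<in> Gn (?R \<alpha> \<union> ?R \<beta>) \<and> g \<in> Gn (?R \<alpha> \<union> ?R \<beta>) \<and>
      omega Q (restr (?R \<alpha>) f) (restr (?R \<alpha>) g) = 1")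
    case True
    then obtain \<alpha> \<beta> f g where ab: "\<alpha> \<noteq> \<beta>" and fg: "f \<in> S" "g \<in> S"
      and fg': "f \<in> Gn (?R \<alpha> \<union> ?R \<beta>)" "g \<in> Gn (?R \<alpha> \<union> ?R \<beta>)"
      and om: "omega Q (restr (?R \<alpha>) f) (restr (?R \<alpha>) g) = 1" by blast
    note f = Un_qubits_of_two_parties[OF ab fg'(1)] and g = Un_qubits_of_two_parties[OF ab fg'(2)]
    \<comment> \<open>The contributions of the two parties to the form add up to zero, so
      anticommutation at \<alpha> forces it at \<beta>.\<close>
    have "0 = omega Q f g" using lagrangian_omega[OF S fg] by simp
    also have "\<dots> = omega Q (restr (?R \<alpha>) f) g + omega Q (restr (?R \<beta>) f) g"
      by (subst f) (rule omega_add_left)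
    also have "\<dots> = omega Q (restr (?R \<alpha>) f) (restr (?R \<alpha>) g) + omega Q (restr (?R \<beta>) f) (restr (?R \<beta>) g)"
      by (simp add: omega_restr_right[OF restr_in_Gn])
    finally have om': "omega Q (restr (?R \<beta>) f) (restr (?R \<beta>) g) = 1"
      using om by simp
    have "omega Q (restr (?R \<gamma>) f) (restr (?R \<gamma>) g) = 1" if "\<gamma> \<in> {\<alpha>, \<beta>}" for \<gamma>
      using that om om' by auto
    then obtain hs q where hs: "\<forall>h\<in>set hs. \<exists>\<gamma>\<in>{\<alpha>, \<beta>}. h \<in> Gn (?R \<gamma>)"
      and q: "\<And>\<gamma>. \<gamma> \<in> {\<alpha>, \<beta>} \<Longrightarrow> q \<gamma> \<in> ?R \<gamma> \<and> trvs Q hs (restr (?R \<gamma>) f) = single (q \<gamma>) (1, 0) \<and>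
        trvs Q hs (restr (?R \<gamma>) g) = single (q \<gamma>) (0, 1)"
      using hyperbolic_pairs_normal_form[OF fin, of "{\<alpha>, \<beta>}" "\<lambda>\<gamma>. restr (?R \<gamma>) f" pty "\<lambda>\<gamma>. restr (?R \<gamma>) g"]
      by auto
    have "trvs Q hs f = single (q \<alpha>) (1, 0) + single (q \<beta>) (1, 0)"
      by (subst f) (simp add: trvs_add q)
    moreover have "trvs Q hs g = single (q \<alpha>) (0, 1) + single (q \<beta>) (0, 1)"
      by (subst g) (simp add: trvs_add q)
    moreover have qs: "q \<alpha> \<in> Q" "q \<beta> \<in> Q" "pty (q \<alpha>) = \<alpha>" "pty (q \<beta>) = \<beta>"
      using q by (auto simp: qubits_of_def)
    moreover from qs ab have "q \<alpha> \<noteq> q \<beta>" by auto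
    ultimately have "ghz_group {{q \<alpha>, q \<beta>}} \<subseteq> trvs Q hs ` S"
      using fg by (intro ghz_group_pair_subset sub) (metis imageI)+
    thus ?thesis
      using that[of hs "{q \<alpha>, q \<beta>}"] hs qs ab \<open>q \<alpha> \<noteq> q \<beta>\<close> by (auto simp: party_local_def inj_on_def)
  next
    case False
    \<comment> \<open>If the owner of \<open>q\<close> shares no nonzero element with \<beta>, the
      orthogonality condition for X at \<open>q\<close> concerns only the zero vector. X then
      extends by a part on \<gamma> to an element of \<open>S\<close>, and its entry at
      \<open>q\<close> shows that it is nonzero.\<close>
    have "\<exists>\<alpha> \<beta> z. \<alpha> \<noteq> \<beta> \<and> z \<in> S \<and> z \<in> Gn (?R \<alpha> \<union> ?R \<beta>) \<and> z \<noteq> 0"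
    proof -
      obtain q where q: "q \<in> Q" using ne by auto
      obtain \<beta> where ab: "pty q \<noteq> \<beta>" by (metis party.distinct(1))
      obtain \<gamma> where c: "\<gamma> \<noteq> pty q" "\<gamma> \<noteq> \<beta>" "UNIV = {pty q, \<beta>, \<gamma>}" using parties[OF ab] by auto
      show ?thesis
      proof (cases "\<exists>z. z \<in> S \<and> z \<in> Gn (?R (pty q) \<union> ?R \<beta>) \<and> z \<noteq> 0")
        case True
        thus ?thesis using ab by blast
      next
        case False
        let ?v = "single q (1, 0)"
        have v: "?v \<in> Gn (?R (pty q))" using q by (auto intro!: single_in_Gn simp: qubits_of_def)
        obtain u where u: "u \<in> Gn (?R \<gamma>)" "?v + u \<in> S"
          by (rule lagrangian_extend[OF fin S Q[OF c(3)] v]) (use False in auto)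
        have "?v + u \<noteq> 0"
        proof
          assume "?v + u = 0"
          hence "(?v + u) q = 0" by simp
          moreover have "u q = 0" using u(1) c(1) by (intro GnD[OF u(1)]) (auto simp: qubits_of_def)
          ultimately show False by (simp add: single_def prod_eq_iff)
        qed
        moreover have "?v + u \<in> Gn (?R (pty q) \<union> ?R \<gamma>)"
          using u(1) v Gn_mono[of _ "?R (pty q) \<union> ?R \<gamma>"] by (intro Gn_add) blast+
        ultimately show ?thesis
          using u(2) not_sym[OF c(1)]
          by (intro exI[of _ "pty q"] exI[of _ \<gamma>] exI[of _ "?v + u"] conjI)
      qed
    qed
    then obtain \<alpha> \<beta> z where ab: "\<alpha> \<noteq> \<beta>" and z: "z \<in> S" "z \<in> Gn (?R \<alpha> \<union> ?R \<beta>)" "z \<noteq> 0" by blast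
    obtain \<gamma> where c: "\<gamma> \<noteq> \<alpha>" "\<gamma> \<noteq> \<beta>" "UNIV = {\<alpha>, \<beta>, \<gamma>}" using parties[OF ab] by auto
    let ?za = "restr (?R \<alpha>) z" and ?zb = "restr (?R \<beta>) z"
    note zab = Un_qubits_of_two_parties[OF ab z(2)]
    have "?za \<noteq> 0"
    proof
      assume "?za = 0"
      hence "z = ?zb" using zab by (metis add_0)
      hence "z \<in> Gn (?R \<beta>)" by (metis restr_in_Gn)
      thus False using no_local z by blast
    qed
    have "omega Q ?za s = 0" if "s \<in> S" "s \<in> Gn (?R \<alpha> \<union> ?R \<beta>)" for s
    proof -
      have "omega Q ?za (restr (?R \<alpha>) s) \<noteq> 1" using False ab z that by blast
      thus ?thesis by (simp add: omega_restr_right[OF restr_in_Gn])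
    qed
    then obtain w where w: "w \<in> Gn (?R \<gamma>)" "?za + w \<in> S"
      using lagrangian_extend[OF fin S Q[OF c(3)] restr_in_Gn] by blast
    have "?za \<notin> S" using no_local \<open>?za \<noteq> 0\<close> restr_in_Gn by blast
    moreover have "?za \<in> Gn Q" using Gn_mono[OF qubits_of_subset] restr_in_Gn by blast
    ultimately have "\<exists>f\<in>S. omega Q ?za f \<noteq> 0" using lagrangian_memI[OF S] by blast
    then obtain f where f: "f \<in> S" and fza: "omega Q f ?za = 1"
      by (auto simp: omega_commute)
    \<comment> \<open>\<open>f\<close> commutes with \<open>z\<close> and with
      \<open>?za + w\<close>, both members of \<open>S\<close>, so anticommutation with the part at
      \<alpha> is passed on to the parts at \<beta> and \<gamma>.\<close>
    have fzb: "omega Q f ?zb = 1"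
      using lagrangian_omega[OF S f z(1)] fza by (subst (asm) zab) (simp add: omega_add_right)
    have fw: "omega Q f w = 1"
      using lagrangian_omega[OF S f w(2)] fza by (simp add: omega_add_right)
    define G where "G \<delta> = (if \<delta> = \<alpha> then ?za else if \<delta> = \<beta> then ?zb else w)" for \<delta>
    have G: "G \<delta> \<in> Gn (?R \<delta>)" for \<delta>
    proof -
      have "\<delta> \<in> {\<alpha>, \<beta>, \<gamma>}" using c(3) by blast
      thus ?thesis using w by (auto simp: G_def)
    qed
    have fG: "omega Q (restr (?R \<delta>) f) (G \<delta>) = 1" for \<delta>
      using fza fzb fw G[of \<delta>] by (simp add: omega_restr_left) (simp add: G_def)
    have "finite (UNIV :: party set)" by (simp add: c(3))
    then obtain hs q where hs: "\<forall>h\<in>set hs. \<exists>\<delta>\<in>UNIV. h \<in> Gn (?R \<delta>)"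
      and q: "\<And>\<delta>. q \<delta> \<in> ?R \<delta> \<and> trvs Q hs (restr (?R \<delta>) f) = single (q \<delta>) (1, 0) \<and>
        trvs Q hs (G \<delta>) = single (q \<delta>) (0, 1)"
      using hyperbolic_pairs_normal_form[OF fin, of UNIV "\<lambda>\<delta>. restr (?R \<delta>) f" pty G] G fG
      by auto
    have fabc: "f = restr (?R \<alpha>) f + (restr (?R \<beta>) f + restr (?R \<gamma>) f)"
    proof
      fix r
      have "pty r = \<alpha> \<or> pty r = \<beta> \<or> pty r = \<gamma>" using c(3) by blast
      thus "f r = (restr (?R \<alpha>) f + (restr (?R \<beta>) f + restr (?R \<gamma>) f)) r"
        using ab c lagrangian_in_Gn[OF S f] by (auto simp: restr_apply qubits_of_def Gn_def)
    qed
    have "trvs Q hs f = single (q \<alpha>) (1, 0) + (single (q \<beta>) (1, 0) + single (q \<gamma>) (1, 0))"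
      by (subst fabc) (simp add: trvs_add q)
    hence X: "single (q \<alpha>) (1, 0) + (single (q \<beta>) (1, 0) + single (q \<gamma>) (1, 0)) \<in> trvs Q hs ` S"
      using f by (metis imageI)
    have "trvs Q hs z = single (q \<alpha>) (0, 1) + single (q \<beta>) (0, 1)"
      using q[of \<alpha>] q[of \<beta>] ab by (subst zab) (simp add: trvs_add G_def)
    hence Z1: "single (q \<alpha>) (0, 1) + single (q \<beta>) (0, 1) \<in> trvs Q hs ` S"
      using z by (metis imageI)
    have "trvs Q hs (?za + w) = single (q \<alpha>) (0, 1) + single (q \<gamma>) (0, 1)"
      using q[of \<alpha>] q[of \<gamma>] c by (simp add: trvs_add G_def)
    hence Z2: "single (q \<alpha>) (0, 1) + single (q \<gamma>) (0, 1) \<in> trvs Q hs ` S"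
      using w by (metis imageI)
    have qs: "q \<delta> \<in> Q" "pty (q \<delta>) = \<delta>" for \<delta>
      using q by (auto simp: qubits_of_def)
    have dist: "distinct [q \<alpha>, q \<beta>, q \<gamma>]"
      using qs(2) ab c by (metis distinct_length_2_or_more distinct_singleton)
    have "ghz_group {{q \<alpha>, q \<beta>, q \<gamma>}} \<subseteq> trvs Q hs ` S"
      by (rule ghz_group_triple_subset[OF dist sub X Z1 Z2])
    moreover have "inj_on pty {q \<alpha>, q \<beta>, q \<gamma>}"
      by (rule inj_onI) (auto simp: qs)
    ultimately show ?thesis
      using that[of hs "{q \<alpha>, q \<beta>, q \<gamma>}"] hs qs(1) dist by (auto simp: party_local_def)
  qed
qed

text \<open>Induction on the set of qubits. The residual group is contained in the transformed one,
  so it has no nonzero local elements either; the circuit found for it lives off the block and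
  therefore fixes the block group.\<close>

lemma lagrangian_normal_form:
  assumes "finite Q" "lagrangian Q S" "full_local_ranks Q pty S"
  shows "\<exists>hs P. (\<forall>h\<in>set hs. party_local Q pty h) \<and> block_partition Q P \<and>
    (\<forall>blk\<in>P. inj_on pty blk \<and> card blk \<ge> 2) \<and> trvs Q hs ` S = ghz_group P"
  using assms
proof (induction Q arbitrary: S rule: finite_psubset_induct)
  case (psubset Q S)
  note fin = psubset.hyps and S = psubset.prems(1) and flr = psubset.prems(2)
  show ?case
  proof (cases "Q = {}")
    case True
    have 0: "f = 0" if "f \<in> Gn {}" for f :: "'a symp"
      using that by (auto simp: Gn_def)
    have "S = {0}" using lagrangian_zero[OF S] lagrangian_in_Gn[OF S] 0 True by blast
    moreover have "ghz_group {} = {0 :: 'a symp}" using 0 by (auto simp: ghz_group_def)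
    ultimately have "S = ghz_group {}" by simp
    thus ?thesis using True
      by (intro exI[of _ "[]"] exI[of _ "{}"]) (simp add: block_partition_def)
  next
    case False
    then obtain hs blk where hs: "\<forall>h\<in>set hs. party_local Q pty h"
      and blk: "blk \<subseteq> Q" "inj_on pty blk" "card blk \<ge> 2" "ghz_group {blk} \<subseteq> trvs Q hs ` S"
      using extract_block[OF fin _ S flr] by metis
    let ?S = "trvs Q hs ` S" and ?Q = "Q - blk"
    let ?S' = "?S \<inter> Gn ?Q"
    have blkne: "blk \<noteq> {}" using blk(3) by auto
    have S1: "lagrangian Q ?S" using lagrangian_trvs[OF S party_local_in_Gn[OF hs]] .
    have S2: "lagrangian ?Q ?S'" by (rule lagrangian_peel[OF fin S1 blk(1,4)])
    have "full_local_ranks Q pty ?S" by (rule full_local_ranks_trvs[OF hs flr])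
    hence "full_local_ranks ?Q pty ?S'"
      using lagrangian_zero[OF S2] unfolding full_local_ranks_def local_sub_def
      by (auto simp: Gn_def)
    moreover have "?Q \<subset> Q" using blk(1) blkne by blast
    ultimately obtain ks P where ks: "\<forall>h\<in>set ks. party_local ?Q pty h" and P: "block_partition ?Q P"
      "\<forall>blk\<in>P. inj_on pty blk \<and> card blk \<ge> 2" and eq: "trvs ?Q ks ` ?S' = ghz_group P"
      using psubset.IH S2 by metis
    have UP: "\<Union>P = ?Q" using P(1) by (simp add: block_partition_def)
    have ksG: "set ks \<subseteq> Gn ?Q" by (rule party_local_in_Gn[OF ks])
    have eq': "trvs Q ks ` ?S' = ghz_group P"
      using eq trvs_subset[OF fin _ ksG] by simp
    have kfix: "trvs Q ks t = t" if "t \<in> ghz_group {blk}" for t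
      using trvs_fix[OF ksG ghz_group_in_Gn[OF that]] by simp
    have disj: "blk \<inter> \<Union>P = {}" using UP by blast
    have "trvs Q ks ` ?S = ghz_group (insert blk P)"
    proof (intro set_eqI iffI)
      fix f assume "f \<in> trvs Q ks ` ?S"
      then obtain g where g: "g \<in> ?S" "f = trvs Q ks g" by blast
      have "f = trvs Q ks (restr blk g) + trvs Q ks (restr ?Q g)"
        using restr_split[OF lagrangian_in_Gn[OF S1 g(1)] blk(1)] g(2) by (metis trvs_add)
      moreover have "restr blk g \<in> ghz_group {blk}"
        by (rule lagrangian_peel_restr_block[OF fin S1 blk(1,4) g(1)])
      moreover have "trvs Q ks (restr ?Q g) \<in> ghz_group P"
        using lagrangian_peel_restr_rest[OF fin S1 blk(1,4) g(1)] eq' by blast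
      ultimately show "f \<in> ghz_group (insert blk P)"
        using kfix by (auto simp: ghz_group_insert[OF disj])
    next
      fix f assume "f \<in> ghz_group (insert blk P)"
      then obtain t s where f: "f = t + s" "t \<in> ghz_group {blk}" "s \<in> ghz_group P"
        by (auto simp: ghz_group_insert[OF disj])
      then obtain g where g: "g \<in> ?S'" "s = trvs Q ks g" using eq' by blast
      have "f = trvs Q ks (t + g)" by (simp add: f(1) g(2) trvs_add kfix[OF f(2)])
      moreover have "t + g \<in> ?S" using lagrangian_add[OF S1] f(2) blk(4) g(1) by blast
      ultimately show "f \<in> trvs Q ks ` ?S" by blast
    qed
    hence "trvs Q (hs @ ks) ` S = ghz_group (insert blk P)"
      by (simp add: image_image[of "trvs Q ks" "trvs Q hs"])
    moreover have "block_partition Q (insert blk P)"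
      using P(1) blk(1) blkne disj unfolding block_partition_def by auto
    moreover have "\<forall>h\<in>set (hs @ ks). party_local Q pty h"
    proof -
      have "qubits_of ?Q pty \<alpha> \<subseteq> qubits_of Q pty \<alpha>" for \<alpha> by (auto simp: qubits_of_def)
      hence "\<forall>h\<in>set ks. party_local Q pty h"
        using ks Gn_mono unfolding party_local_def by blast
      thus ?thesis using hs by auto
    qed
    ultimately show ?thesis using P(2) blk by (metis insertE)
  qed
qed

subsection \<open>Counting the blocks\<close>

interpretation F2: vector_space "f2scale :: bit \<Rightarrow> 'q symp \<Rightarrow> 'q symp"
  by unfold_locales (auto simp: f2scale_def fun_eq_iff prod_eq_iff distrib_left distrib_right mult.assoc)

lemma f2scale_simps [simp]: "f2scale 1 f = f" "f2scale 0 f = 0"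
  by (simp_all add: f2scale_def fun_eq_iff prod_eq_iff)

lemma subspace_f2subspace:
  assumes "f2subspace S"
  shows "F2.subspace S"
proof (rule F2.subspaceI)
  show "f2scale c f \<in> S" if "f \<in> S" for c f
    using assms that by (cases c) (auto simp: f2subspace_def)
qed (use assms in \<open>auto simp: f2subspace_def\<close>)

text \<open>Adjoining an independent vector adds one disjoint coset of the same size, which doubles
  the order.\<close>

lemma card_F2_span:
  assumes "finite B" "\<not> F2.dependent B"
  shows "finite (F2.span B) \<and> card (F2.span B) = 2 ^ card B"
  using assms
proof (induction B rule: finite_induct)
  case empty
  show ?case by (simp add: F2.span_empty)
next
  case (insert b B)
  have ind: "\<not> F2.dependent B" and b: "b \<notin> F2.span B"
    using insert.prems insert.hyps by (simp_all add: F2.independent_insert)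
  note IH = insert.IH[OF ind]
  have minus: "x - y = x + y" for x y :: "'a symp"
    by (simp add: fun_eq_iff prod_eq_iff)
  have "F2.span (insert b B) = F2.span B \<union> (\<lambda>x. x + b) ` F2.span B"
  proof (intro set_eqI iffI)
    fix x assume "x \<in> F2.span (insert b B)"
    then obtain k where "x + f2scale k b \<in> F2.span B"
      by (auto simp: F2.span_insert minus)
    thus "x \<in> F2.span B \<union> (\<lambda>x. x + b) ` F2.span B"
      by (cases k) (auto simp: image_iff, metis add.commute symp_add_self_left)
  next
    fix x assume "x \<in> F2.span B \<union> (\<lambda>x. x + b) ` F2.span B"
    thus "x \<in> F2.span (insert b B)"
      using F2.span_mono[of B "insert b B"] F2.span_base[of b "insert b B"]
      by (auto intro!: F2.span_add)
  qed
  moreover have "F2.span B \<inter> (\<lambda>x. x + b) ` F2.span B = {}"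
  proof -
    have False if "x \<in> F2.span B" "x + b \<in> F2.span B" for x
      using F2.span_add[OF that] b by simp
    thus ?thesis by auto
  qed
  moreover have "card ((\<lambda>x. x + b) ` F2.span B) = card (F2.span B)"
    by (rule card_image) (simp add: inj_on_def)
  ultimately show ?case
    using IH insert.hyps by (simp add: card_Un_disjoint)
qed

text \<open>Turns dimensions into orders, for which direct sums over disjoint blocks are plain
  products.\<close>

lemma card_f2subspace:
  assumes "finite S" "f2subspace S"
  shows "card S = 2 ^ f2dim S"
proof -
  obtain B where B: "B \<subseteq> S" "\<not> F2.dependent B" "S \<subseteq> F2.span B" "card B = F2.dim S"
    using F2.basis_exists by blast
  have "F2.span B = S"
    using B F2.span_minimal[OF B(1) subspace_f2subspace[OF assms(2)]] by blast
  thus ?thesis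
    using card_F2_span[of B] B finite_subset[OF B(1) assms(1)] by (simp add: f2dim_def)
qed

section \<open>Orders of block groups and of their co-local subgroups\<close>

lemma direct_sum_eq:
  assumes "T \<subseteq> Gn W" "S \<subseteq> Gn W'" "W \<inter> W' = {}"
    and "t \<in> T" "t' \<in> T" "s \<in> S" "s' \<in> S" "t + s = t' + s'"
  shows "t = t' \<and> s = s'"
proof -
  have "t q = t' q \<and> s q = s' q" for q
  proof -
    have "t q + s q = t' q + s' q" using fun_cong[OF assms(8), of q] by simp
    moreover have "q \<notin> W \<or> q \<notin> W'" using assms(3) by blast
    moreover have "t q = 0" "t' q = 0" if "q \<notin> W" using that assms(1,4,5) by (auto intro: GnD)
    moreover have "s q = 0" "s' q = 0" if "q \<notin> W'" using that assms(2,6,7) by (auto intro: GnD)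
    ultimately show ?thesis by (metis add_0 add.right_neutral)
  qed
  thus ?thesis by (simp add: fun_eq_iff)
qed

lemma card_direct_sum:
  assumes "T \<subseteq> Gn W" "S \<subseteq> Gn W'" "W \<inter> W' = {}"
  shows "card (T + S) = card T * card S"
proof -
  have "T + S = (\<lambda>(t, s). t + s) ` (T \<times> S)"
    by (auto simp: set_plus_def image_iff)
  moreover have "inj_on (\<lambda>(t, s). t + s) (T \<times> S)"
    using direct_sum_eq[OF assms] by (auto intro!: inj_onI)
  ultimately show ?thesis by (simp add: card_image card_cartesian_product)
qed

text \<open>With disjoint supports the parts of the two summands on \<alpha> cannot cancel.\<close>

lemma colocal_sub_direct_sum:
  assumes "T \<subseteq> Gn W" "S \<subseteq> Gn W'" "W \<inter> W' = {}"
  shows "colocal_sub Q pty (T + S) \<alpha> = colocal_sub Q pty T \<alpha> + colocal_sub Q pty S \<alpha>"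
proof (intro set_eqI iffI)
  fix f assume "f \<in> colocal_sub Q pty (T + S) \<alpha>"
  then obtain t s where f: "f = t + s" "t \<in> T" "s \<in> S" "restr (qubits_of Q pty \<alpha>) (t + s) = 0"
    by (auto simp: colocal_sub_restr set_plus_def)
  let ?R = "restr (qubits_of Q pty \<alpha>)"
  have "?R t \<in> Gn W" "?R s \<in> Gn W'"
    using assms f by (auto simp: Gn_def restr_def)
  moreover have "?R t + ?R s = 0 + 0" using f(4) by (simp add: restr_add)
  ultimately have "?R t = 0 \<and> ?R s = 0"
    using direct_sum_eq[OF order.refl order.refl assms(3) _ Gn_zero _ Gn_zero] by blast
  thus "f \<in> colocal_sub Q pty T \<alpha> + colocal_sub Q pty S \<alpha>"
    using f by (auto simp: colocal_sub_restr intro: set_plus_intro)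
qed (auto simp: colocal_sub_restr set_plus_def restr_add)

lemma S_loc_set_plus:
  "S_loc Q pty S = colocal_sub Q pty S PA + colocal_sub Q pty S PB + colocal_sub Q pty S PC"
  unfolding S_loc_def set_plus_def by (auto; blast)

lemma S_loc_direct_sum:
  assumes "T \<subseteq> Gn W" "S \<subseteq> Gn W'" "W \<inter> W' = {}"
  shows "S_loc Q pty (T + S) = S_loc Q pty T + S_loc Q pty S"
  unfolding S_loc_set_plus colocal_sub_direct_sum[OF assms] by (simp only: ac_simps)

lemma colocal_sub_subset: "colocal_sub Q pty S \<alpha> \<subseteq> S"
  by (auto simp: colocal_sub_def)

lemma S_loc_subset_Gn: "S \<subseteq> Gn W \<Longrightarrow> S_loc Q pty S \<subseteq> Gn W"
  using colocal_sub_subset by (fastforce simp: S_loc_def intro!: Gn_add)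

lemma f2subspace_colocal_sub: "f2subspace S \<Longrightarrow> f2subspace (colocal_sub Q pty S \<alpha>)"
  by (simp add: f2subspace_def colocal_sub_restr restr_add)

lemma f2subspace_S_loc:
  assumes "f2subspace S"
  shows "f2subspace (S_loc Q pty S)"
  unfolding f2subspace_def
proof (intro conjI ballI)
  have C: "0 \<in> colocal_sub Q pty S \<alpha>"
    "f \<in> colocal_sub Q pty S \<alpha> \<Longrightarrow> g \<in> colocal_sub Q pty S \<alpha> \<Longrightarrow> f + g \<in> colocal_sub Q pty S \<alpha>" for \<alpha> f g
    using f2subspace_colocal_sub[OF assms, of Q pty \<alpha>] by (auto simp: f2subspace_def)
  show "0 \<in> S_loc Q pty S" unfolding S_loc_def using C(1) by (metis (mono_tags, lifting) add_0 mem_Collect_eq)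
  fix f g assume "f \<in> S_loc Q pty S" "g \<in> S_loc Q pty S"
  then obtain a b c a' b' c' where
    "f = a + b + c" "a \<in> colocal_sub Q pty S PA" "b \<in> colocal_sub Q pty S PB" "c \<in> colocal_sub Q pty S PC"
    "g = a' + b' + c'" "a' \<in> colocal_sub Q pty S PA" "b' \<in> colocal_sub Q pty S PB" "c' \<in> colocal_sub Q pty S PC"
    unfolding S_loc_def by auto
  moreover from this have "f + g = (a + a') + (b + b') + (c + c')" by (simp add: add_ac)
  ultimately show "f + g \<in> S_loc Q pty S" unfolding S_loc_def using C(2) by blast
qed

lemma zero_set_plus [simp]: "{0} + T = (T :: 'q symp set)" "T + {0} = T"
  by (auto simp: set_plus_def)

lemma card_UNIV_bit: "card (UNIV :: bit set) = 2"
  by (simp add: UNIV_bit)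

text \<open>Both ends carry the same Pauli, so vanishing at either end kills the element, while a
  party that owns neither end imposes no condition.\<close>

lemma colocal_sub_pair:
  assumes "q \<noteq> r" "q \<in> Q" "r \<in> Q"
  shows "colocal_sub Q pty (ghz_group {{q, r}}) \<alpha> =
    (if \<alpha> \<in> {pty q, pty r} then {0} else ghz_group {{q, r}})"
proof -
  have *: "(single q v + single r v) p = (if p \<in> {q, r} then v else 0)" for v p
    using assms by (auto simp: single_def)
  have s0: "single p 0 = 0" for p :: 'a
    by (simp add: single_def fun_eq_iff)
  show ?thesis
  proof (cases "\<alpha> \<in> {pty q, pty r}")
    case True
    have "v = 0" if "\<forall>p\<in>Q. pty p = \<alpha> \<longrightarrow> (single q v + single r v) p = 0" for v
      using that True assms unfolding * by auto
    moreover have "0 \<in> range (\<lambda>v. single q v + single r v)"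
      by (rule image_eqI[of _ _ 0]) (simp_all add: s0)
    ultimately have "colocal_sub Q pty (ghz_group {{q, r}}) \<alpha> = {0}"
      unfolding colocal_sub_def ghz_group_pair[OF assms(1)] by (force simp: s0)
    thus ?thesis using True by simp
  next
    case False
    thus ?thesis
      unfolding colocal_sub_def ghz_group_pair[OF assms(1)] by (auto simp: single_apply)
  qed
qed

lemma card_ghz_group_pair:
  assumes "q \<noteq> r"
  shows "card (ghz_group {{q, r}}) = 4"
proof -
  have "inj (\<lambda>v. single q v + single r v)"
  proof (rule injI)
    fix v w assume "single q v + single r v = single q w + single r w"
    thus "v = w" using assms by (auto dest!: fun_cong[of _ _ q] simp: single_apply)
  qed
  hence "card (ghz_group {{q, r}}) = card (UNIV :: (bit \<times> bit) set)"
    by (simp add: ghz_group_pair[OF assms] card_image)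
  thus ?thesis
    by (simp add: card_cartesian_product card_UNIV_bit flip: UNIV_Times_UNIV)
qed

lemma single_add: "single q (a, b) + single q (a', b') = single q (a + a', b + b')"
  by (auto simp: single_def fun_eq_iff)

lemma triple_vec_add:
  "triple_vec q r s a b c + triple_vec q r s a' b' c' = triple_vec q r s (a + a') (b + b') (c + c')"
proof -
  have eq: "(b + b') + (c + c') = (b + c) + (b' + c')" by (simp only: ac_simps)
  show ?thesis unfolding triple_vec_def eq single_add[symmetric] by (simp only: ac_simps)
qed

lemma triple_vec_apply:
  assumes "distinct [q, r, s]"
  shows "triple_vec q r s a b c q = (a, b + c)" "triple_vec q r s a b c r = (a, b)"
    "triple_vec q r s a b c s = (a, c)" "p \<notin> {q, r, s} \<Longrightarrow> triple_vec q r s a b c p = 0"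
  using assms by (auto simp: triple_vec_def single_def)

lemma triple_vec_inject:
  assumes "distinct [q, r, s]"
  shows "triple_vec q r s a b c = triple_vec q r s a' b' c' \<longleftrightarrow> a = a' \<and> b = b' \<and> c = c'"
  using triple_vec_apply(2,3)[OF assms] by (metis prod.inject)

lemma bit_add_eq_0_iff': "(a::bit) + b = 0 \<longleftrightarrow> a = b"
  by (cases a; cases b) simp_all

text \<open>Vanishing at one qubit forces \<open>a = 0\<close> and one relation between
  \<open>b\<close> and \<open>c\<close>, so each co-local subgroup is generated by a single ZZ.
  Together they generate the Z part, and XXX represents the only other coset: a GHZ block
  contributes exactly one to p.\<close>

lemma colocal_sub_triple:
  assumes "q \<in> Q" "r \<in> Q" "s \<in> Q" "pty q = PA" "pty r = PB" "pty s = PC"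
  shows "colocal_sub Q pty (ghz_group {{q, r, s}}) PA = {triple_vec q r s 0 b b | b. True}"
    and "colocal_sub Q pty (ghz_group {{q, r, s}}) PB = {triple_vec q r s 0 0 c | c. True}"
    and "colocal_sub Q pty (ghz_group {{q, r, s}}) PC = {triple_vec q r s 0 b 0 | b. True}"
    and "S_loc Q pty (ghz_group {{q, r, s}}) = {triple_vec q r s 0 b c | b c. True}"
proof -
  have dist: "distinct [q, r, s]" using assms by auto
  note app = triple_vec_apply[OF dist]
  have vanish: "(\<forall>p\<in>Q. pty p = \<alpha> \<longrightarrow> triple_vec q r s a b c p = 0) \<longleftrightarrow>
      (\<forall>p\<in>{q, r, s}. pty p = \<alpha> \<longrightarrow> triple_vec q r s a b c p = 0)" for \<alpha> a b c
    using app(4) assms by blast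
  have at: "(\<forall>p\<in>{q, r, s}. pty p = PA \<longrightarrow> f p = 0) \<longleftrightarrow> f q = 0"
    "(\<forall>p\<in>{q, r, s}. pty p = PB \<longrightarrow> f p = 0) \<longleftrightarrow> f r = 0"
    "(\<forall>p\<in>{q, r, s}. pty p = PC \<longrightarrow> f p = 0) \<longleftrightarrow> f s = 0" for f :: "'a symp"
    using assms by simp_all
  have A: "(\<forall>p\<in>Q. pty p = PA \<longrightarrow> triple_vec q r s a b c p = 0) \<longleftrightarrow> a = 0 \<and> b = c" for a b c
    unfolding vanish at app by (simp only: zero_prod_def prod.inject bit_add_eq_0_iff')
  have B: "(\<forall>p\<in>Q. pty p = PB \<longrightarrow> triple_vec q r s a b c p = 0) \<longleftrightarrow> a = 0 \<and> b = 0" for a b c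
    unfolding vanish at app by (simp only: zero_prod_def prod.inject)
  have C: "(\<forall>p\<in>Q. pty p = PC \<longrightarrow> triple_vec q r s a b c p = 0) \<longleftrightarrow> a = 0 \<and> c = 0" for a b c
    unfolding vanish at app by (simp only: zero_prod_def prod.inject)
  have filter: "{g \<in> {triple_vec q r s a b c | a b c. True}. R g} =
      {triple_vec q r s a b c | a b c. R (triple_vec q r s a b c)}" for R by blast
  show cA: "colocal_sub Q pty (ghz_group {{q, r, s}}) PA = {triple_vec q r s 0 b b | b. True}"
    unfolding colocal_sub_def ghz_group_triple[OF dist] filter A by auto
  show cB: "colocal_sub Q pty (ghz_group {{q, r, s}}) PB = {triple_vec q r s 0 0 c | c. True}"
    unfolding colocal_sub_def ghz_group_triple[OF dist] filter B by auto
  show cC: "colocal_sub Q pty (ghz_group {{q, r, s}}) PC = {triple_vec q r s 0 b 0 | b. True}"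
    unfolding colocal_sub_def ghz_group_triple[OF dist] filter C by auto
  show "S_loc Q pty (ghz_group {{q, r, s}}) = {triple_vec q r s 0 b c | b c. True}"
  proof (intro set_eqI iffI)
    fix f assume "f \<in> S_loc Q pty (ghz_group {{q, r, s}})"
    thus "f \<in> {triple_vec q r s 0 b c | b c. True}"
      unfolding S_loc_def cA cB cC by (auto simp: triple_vec_add; blast)
  next
    fix f assume "f \<in> {triple_vec q r s 0 b c | b c. True}"
    then obtain b c where "f = triple_vec q r s 0 b c" by blast
    \<comment> \<open>The summands follow the order \<open>PA\<close>, \<open>PB\<close>,
      \<open>PC\<close>; the contribution of \<open>PA\<close> can be taken to be zero.\<close>
    hence "f = triple_vec q r s 0 0 0 + triple_vec q r s 0 0 c + triple_vec q r s 0 b 0"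
      unfolding triple_vec_add by (simp only: add_0 add.right_neutral)
    thus "f \<in> S_loc Q pty (ghz_group {{q, r, s}})"
      unfolding S_loc_def cA cB cC by blast
  qed
qed

text \<open>Injectivity of \<open>pty\<close> leaves blocks of two or three qubits. In the product,
  4 is the order of an EPR group, which lies entirely in the co-local subgroup of the party outside
  the pair. The 2 is the order of a co-local subgroup of a GHZ block, and also the index of the
  subgroup that these generate.\<close>

lemma
  assumes Q: "blk \<subseteq> Q" and inj: "inj_on pty blk" and card2: "card blk \<ge> 2"
  shows card_colocal_sub_block: "card (colocal_sub Q pty (ghz_group {blk}) \<alpha>) =
      (if pty ` blk = UNIV - {\<alpha>} then 4 else 1) * (if pty ` blk = UNIV then 2 else 1)"
    and card_S_loc_block: "card (ghz_group {blk}) =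
      card (S_loc Q pty (ghz_group {blk})) * (if pty ` blk = UNIV then 2 else 1)"
proof -
  have "card (colocal_sub Q pty (ghz_group {blk}) \<alpha>) =
      (if pty ` blk = UNIV - {\<alpha>} then 4 else 1) * (if pty ` blk = UNIV then 2 else 1) \<and>
    card (ghz_group {blk}) = card (S_loc Q pty (ghz_group {blk})) * (if pty ` blk = UNIV then 2 else 1)"
  proof (cases "pty ` blk = UNIV")
    case True
    then obtain q r s where p: "q \<in> blk" "pty q = PA" "r \<in> blk" "pty r = PB" "s \<in> blk" "pty s = PC"
      by (metis UNIV_I imageE)
    have "t \<in> {q, r, s}" if "t \<in> blk" for t
      using that p inj by (cases "pty t") (metis inj_onD insertCI)+
    hence blk: "blk = {q, r, s}" using p by auto
    have pQ: "q \<in> Q" "r \<in> Q" "s \<in> Q" using p Q by auto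
    have dist: "distinct [q, r, s]" using p by auto
    note inject = triple_vec_inject[OF dist]
    note co = colocal_sub_triple[OF pQ p(2,4,6)]
    have c1: "card {F b | b. True} = 2" if "\<And>b b'. F b = F b' \<Longrightarrow> b = b'" for F :: "bit \<Rightarrow> 'a symp"
    proof -
      have "{F b | b. True} = range F" by auto
      thus ?thesis using that card_image[of F UNIV] by (simp add: inj_def card_UNIV_bit)
    qed
    have "card (ghz_group {blk}) = 8"
    proof -
      have "ghz_group {blk} = (\<lambda>(a, b, c). triple_vec q r s a b c) ` (UNIV \<times> UNIV \<times> UNIV)"
        unfolding blk ghz_group_triple[OF dist] by (auto simp: image_iff; blast)
      moreover have "inj_on (\<lambda>(a, b, c). triple_vec q r s a b c) (UNIV \<times> UNIV \<times> UNIV)"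
        by (auto simp: inj_on_def inject)
      ultimately show ?thesis
        by (simp add: card_image card_cartesian_product card_UNIV_bit del: UNIV_Times_UNIV)
    qed
    moreover have "card (S_loc Q pty (ghz_group {blk})) = 4"
    proof -
      have "S_loc Q pty (ghz_group {blk}) = (\<lambda>(b, c). triple_vec q r s 0 b c) ` (UNIV \<times> UNIV)"
        unfolding blk co(4) by (auto simp: image_iff)
      moreover have "inj_on (\<lambda>(b, c). triple_vec q r s 0 b c) (UNIV \<times> UNIV)"
        by (auto simp: inj_on_def inject)
      ultimately show ?thesis
        by (simp add: card_image card_cartesian_product card_UNIV_bit del: UNIV_Times_UNIV)
    qed
    moreover have "card (colocal_sub Q pty (ghz_group {blk}) \<alpha>) = 2"
    proof -
      have "card {triple_vec q r s 0 b b | b. True} = 2" "card {triple_vec q r s 0 0 b | b. True} = 2"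
        "card {triple_vec q r s 0 b 0 | b. True} = 2"
        by (rule c1, simp add: inject)+
      thus ?thesis unfolding blk by (cases \<alpha>) (simp_all only: co)
    qed
    moreover have "UNIV \<noteq> UNIV - {\<alpha>}" by blast
    ultimately show ?thesis using True by simp
  next
    case False
    have "card (pty ` blk) < card (UNIV :: party set)"
      by (intro psubset_card_mono psubsetI subset_UNIV False) (simp add: UNIV_party)
    hence "card blk = 2" using card2 card_image[OF inj] by (simp add: UNIV_party)
    then obtain q r where blk: "blk = {q, r}" and qr: "q \<noteq> r" by (auto simp: card_2_iff)
    have pty: "pty q \<noteq> pty r" using inj qr by (auto simp: blk)
    have "q \<in> Q" "r \<in> Q" using Q by (auto simp: blk)
    note co = colocal_sub_pair[OF qr this]
    have "pty ` blk = UNIV - {\<alpha>} \<longleftrightarrow> \<alpha> \<notin> {pty q, pty r}"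
      using pty unfolding blk UNIV_party by (cases \<alpha>; cases "pty q"; cases "pty r") auto
    hence "card (colocal_sub Q pty (ghz_group {blk}) \<alpha>) = (if pty ` blk = UNIV - {\<alpha>} then 4 else 1)"
      unfolding blk co by (simp add: card_ghz_group_pair[OF qr])
    moreover have "S_loc Q pty (ghz_group {blk}) = ghz_group {blk}"
      unfolding S_loc_set_plus blk co using pty by (cases "pty q"; cases "pty r") simp_all
    ultimately show ?thesis using False by simp
  qed
  thus "card (colocal_sub Q pty (ghz_group {blk}) \<alpha>) =
      (if pty ` blk = UNIV - {\<alpha>} then 4 else 1) * (if pty ` blk = UNIV then 2 else 1)"
    "card (ghz_group {blk}) =
      card (S_loc Q pty (ghz_group {blk})) * (if pty ` blk = UNIV then 2 else 1)"
    by blast+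
qed

text \<open>All orders involved multiply over disjoint blocks, so the exponents count blocks. The
  base 4 for pairs is why d(\<alpha>) - p turns out even.\<close>

lemma
  assumes "finite P" "\<And>b b'. b \<in> P \<Longrightarrow> b' \<in> P \<Longrightarrow> b \<noteq> b' \<Longrightarrow> b \<inter> b' = {}"
    and "\<And>blk. blk \<in> P \<Longrightarrow> blk \<subseteq> Q \<and> inj_on pty blk \<and> card blk \<ge> 2"
  shows card_colocal_sub_ghz_group: "card (colocal_sub Q pty (ghz_group P) \<alpha>) =
      4 ^ card {blk\<in>P. pty ` blk = UNIV - {\<alpha>}} * 2 ^ card {blk\<in>P. pty ` blk = UNIV}" (is ?A)
    and card_S_loc_ghz_group: "card (ghz_group P) =
      card (S_loc Q pty (ghz_group P)) * 2 ^ card {blk\<in>P. pty ` blk = UNIV}" (is ?B)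
proof -
  have "?A \<and> ?B"
    using assms
  proof (induction P rule: finite_induct)
    case empty
    have "ghz_group {} = {0 :: 'a symp}" by (auto simp: ghz_group_def Gn_def)
    moreover have "colocal_sub Q pty {0} \<beta> = {0}" for \<beta>
      by (auto simp: colocal_sub_def)
    ultimately show ?case by (simp add: S_loc_set_plus)
  next
    case (insert blk P)
    have disj: "blk \<inter> \<Union>P = {}" using insert.prems(1)[of blk] insert.hyps by blast
    have eq: "ghz_group (insert blk P) = ghz_group {blk} + ghz_group P"
      unfolding ghz_group_insert[OF disj] set_plus_def by blast
    have G: "ghz_group {blk} \<subseteq> Gn blk" "ghz_group P \<subseteq> Gn (\<Union>P)"
      using ghz_group_in_Gn by force+
    have co: "colocal_sub Q pty (ghz_group {blk}) \<alpha> \<subseteq> Gn blk" "colocal_sub Q pty (ghz_group P) \<alpha> \<subseteq> Gn (\<Union>P)"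
      using G colocal_sub_subset by blast+
    have filter: "card {b \<in> insert blk P. R b} = (if R blk then 1 else 0) + card {b \<in> P. R b}" for R
    proof -
      have "{b \<in> insert blk P. R b} = (if R blk then insert blk {b \<in> P. R b} else {b \<in> P. R b})" by auto
      thus ?thesis using insert.hyps by simp
    qed
    have blk: "blk \<subseteq> Q" "inj_on pty blk" "card blk \<ge> 2" using insert.prems(2) by auto
    have IH: "card (colocal_sub Q pty (ghz_group P) \<alpha>) =
      4 ^ card {blk\<in>P. pty ` blk = UNIV - {\<alpha>}} * 2 ^ card {blk\<in>P. pty ` blk = UNIV}"
      "card (ghz_group P) = card (S_loc Q pty (ghz_group P)) * 2 ^ card {blk\<in>P. pty ` blk = UNIV}"
      using insert.IH insert.prems by auto
    show ?case
      unfolding eq colocal_sub_direct_sum[OF G disj] S_loc_direct_sum[OF G disj]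
        card_direct_sum[OF co disj] card_direct_sum[OF G disj]
        card_direct_sum[OF S_loc_subset_Gn[OF G(1)] S_loc_subset_Gn[OF G(2)] disj]
        IH card_colocal_sub_block[OF blk] card_S_loc_block[OF blk] filter
      by (simp add: power_add)
  qed
  thus ?A ?B by blast+
qed

text \<open>The circuit is injective and carries co-local subgroups and their sum to those of the
  block group, so the orders can be computed there and the powers of two compared.\<close>

lemma ghz_group_dims:
  fixes Q :: "'q set"
  assumes fin: "finite Q" and S: "lagrangian Q S" and hs: "\<forall>h\<in>set hs. party_local Q pty h"
    and P: "block_partition Q P" "\<forall>blk\<in>P. inj_on pty blk \<and> card blk \<ge> 2"
    and eq: "trvs Q hs ` S = ghz_group P"
  shows "f2dim (colocal_sub Q pty S \<alpha>) =
      2 * card {blk\<in>P. pty ` blk = UNIV - {\<alpha>}} + card {blk\<in>P. pty ` blk = UNIV}"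
    and "f2dim S = f2dim (S_loc Q pty S) + card {blk\<in>P. pty ` blk = UNIV}"
proof -
  have finS: "finite S" and sub: "f2subspace S" and SG: "S \<subseteq> Gn Q"
    using S finite_subset finite_Gn[OF fin] by (auto simp: lagrangian_def)
  have UP: "\<Union>P = Q" and disj: "\<And>b b'. b \<in> P \<Longrightarrow> b' \<in> P \<Longrightarrow> b \<noteq> b' \<Longrightarrow> b \<inter> b' = {}"
    using P(1) by (auto simp: block_partition_def)
  have finP: "finite P" using fin UP finite_UnionD by blast
  have blk: "\<And>blk. blk \<in> P \<Longrightarrow> blk \<subseteq> Q \<and> inj_on pty blk \<and> card blk \<ge> 2"
    using UP P(2) by blast
  have card_image: "card (trvs Q hs ` T) = card T" for T
    by (rule card_image) (rule inj_on_subset[OF inj_trvs], simp)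
  let ?n = "\<lambda>J. card {blk\<in>P. pty ` blk = J}"
  have "2 ^ f2dim (colocal_sub Q pty S \<alpha>) = card (colocal_sub Q pty S \<alpha>)"
    by (intro card_f2subspace[symmetric] f2subspace_colocal_sub sub
        finite_subset[OF colocal_sub_subset finS])
  also have "\<dots> = card (colocal_sub Q pty (ghz_group P) \<alpha>)"
    by (simp add: card_image colocal_sub_trvs[OF hs] flip: eq)
  also have "\<dots> = 4 ^ ?n (UNIV - {\<alpha>}) * 2 ^ ?n UNIV"
    by (rule card_colocal_sub_ghz_group[OF finP disj blk])
  also have "\<dots> = 2 ^ (2 * ?n (UNIV - {\<alpha>}) + ?n UNIV)"
    by (simp add: power_add power_mult)
  finally show "f2dim (colocal_sub Q pty S \<alpha>) = 2 * ?n (UNIV - {\<alpha>}) + ?n UNIV"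
    by (simp add: power_inject_exp)
  have "finite (S_loc Q pty S)"
    using S_loc_subset_Gn[OF SG] finite_Gn[OF fin] finite_subset by blast
  hence card_loc: "2 ^ f2dim (S_loc Q pty S) = card (S_loc Q pty S)"
    using card_f2subspace f2subspace_S_loc[OF sub] by metis
  have "2 ^ f2dim S = card S" using card_f2subspace[OF finS sub] by simp
  also have "\<dots> = card (ghz_group P)" by (simp add: card_image flip: eq)
  also have "\<dots> = card (S_loc Q pty (ghz_group P)) * 2 ^ ?n UNIV"
    by (rule card_S_loc_ghz_group[OF finP disj blk])
  also have "card (S_loc Q pty (ghz_group P)) = card (S_loc Q pty S)"
    by (simp add: card_image S_loc_trvs[OF hs] flip: eq)
  also have "card (S_loc Q pty S) * 2 ^ ?n UNIV = 2 ^ (f2dim (S_loc Q pty S) + ?n UNIV)"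
    by (simp add: power_add card_loc)
  finally show "f2dim S = f2dim (S_loc Q pty S) + ?n UNIV"
    by (simp add: power_inject_exp)
qed

text \<open>No party occurs twice in the block, so the set of its parties determines the type. The
  counting uses this set, which does not depend on an order of the two parties.\<close>

lemma pair_block_iff:
  assumes "inj_on pty blk"
  shows "pair_block pty \<alpha> \<beta> blk \<longleftrightarrow> pty ` blk = {\<alpha>, \<beta>}"
proof
  assume "pty ` blk = {\<alpha>, \<beta>}"
  then obtain q r where p: "q \<in> blk" "pty q = \<alpha>" "r \<in> blk" "pty r = \<beta>"
    by (metis imageE insertCI)
  have "t \<in> {q, r}" if "t \<in> blk" for t
  proof -
    have "pty t \<in> {\<alpha>, \<beta>}" using \<open>pty ` blk = {\<alpha>, \<beta>}\<close> that by blast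
    thus ?thesis using p inj_onD[OF assms _ that] by auto
  qed
  hence "blk = {q, r}" using p by auto
  thus "pair_block pty \<alpha> \<beta> blk" using p unfolding pair_block_def by blast
qed (auto simp: pair_block_def)

lemma triple_block_iff:
  assumes "inj_on pty blk"
  shows "triple_block pty blk \<longleftrightarrow> pty ` blk = UNIV"
proof
  assume "pty ` blk = UNIV"
  then obtain q r s where p: "q \<in> blk" "pty q = PA" "r \<in> blk" "pty r = PB" "s \<in> blk" "pty s = PC"
    by (metis UNIV_I imageE)
  have "t \<in> {q, r, s}" if "t \<in> blk" for t
    using that p assms by (cases "pty t") (metis inj_onD insertCI)+
  hence "blk = {q, r, s}" using p by auto
  thus "triple_block pty blk" using p unfolding triple_block_def by blast
qed (auto simp: triple_block_def UNIV_party)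

subsection \<open>Pauli and Clifford operators\<close>

definition flip :: "'q symp \<Rightarrow> 'q set \<Rightarrow> 'q set" where
  "flip f x = {q. (q \<in> x) \<noteq> (fst (f q) = 1)}"

text \<open>The only nonzero entry in row \<open>b\<close> of a Pauli matrix; its column is the
  negation of \<open>b\<close> exactly if there is an X part.\<close>

definition phase1 :: "bit \<times> bit \<Rightarrow> bool \<Rightarrow> complex" where
  "phase1 v b = sigma1 v b (b \<noteq> (fst v = 1))"

definition phase :: "'q set \<Rightarrow> 'q symp \<Rightarrow> 'q set \<Rightarrow> complex" where
  "phase R f x = (\<Prod>q\<in>R. phase1 (f q) (q \<in> x))"

text \<open>Each row of a Pauli matrix has a single nonzero entry, so the operator is a relabelling
  with phases and products need no sums. The product rule holds at every label; only the comparison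
  with matrices restricts labels to subsets of \<open>R\<close>.\<close>

definition pauli_act :: "'q set \<Rightarrow> 'q symp \<Rightarrow> 'q state \<Rightarrow> 'q state" where
  "pauli_act R f \<psi> x = phase R f x * \<psi> (flip f x)"

text \<open>The phase in \<sigma>(v) \<sigma>(w) = \<open>twist1 v w\<close> \<sigma>(v + w). The
  three pairs singled out are XZ = -\<i>Y, ZY = -\<i>X and YX = -\<i>Z.\<close>

definition twist1 :: "bit \<times> bit \<Rightarrow> bit \<times> bit \<Rightarrow> complex" where
  "twist1 v w = (if fst v * snd w + snd v * fst w = 0 then 1
     else if v = (1, 0) \<and> w = (0, 1) \<or> v = (0, 1) \<and> w = (1, 1) \<or> v = (1, 1) \<and> w = (1, 0)
     then - \<i> else \<i>)"

definition twist :: "'q set \<Rightarrow> 'q symp \<Rightarrow> 'q symp \<Rightarrow> complex" where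
  "twist R f g = (\<Prod>q\<in>R. twist1 (f q) (g q))"

lemma flip_in_Pow: "f \<in> Gn R \<Longrightarrow> x \<subseteq> R \<Longrightarrow> flip f x \<subseteq> R"
  by (auto simp: flip_def Gn_def)

lemma flip_flip_add: "flip f (flip g x) = flip (f + g) x"
  by (auto simp: flip_def)

lemma flip_zero [simp]: "flip 0 x = x"
  by (simp add: flip_def)

lemma flip_flip [simp]: "flip f (flip f x) = x"
  by (simp add: flip_flip_add)

lemma phase1_mult:
  "phase1 v b * phase1 w (b \<noteq> (fst v = 1)) = twist1 v w * phase1 (v + w) b"
  by (cases v; cases w; cases "fst v"; cases "snd v"; cases "fst w"; cases "snd w"; cases b;
      simp add: phase1_def sigma1_def twist1_def zero_prod_def)

lemma phase_mult: "phase R f x * phase R g (flip f x) = twist R f g * phase R (f + g) x"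
  unfolding phase_def twist_def prod.distrib[symmetric]
  by (intro prod.cong refl) (simp only: flip_def mem_Collect_eq phase1_mult plus_fun_apply)

lemma pauli_act_mult:
  "pauli_act R f (pauli_act R g \<psi>) x = twist R f g * pauli_act R (f + g) \<psi> x"
  by (simp add: pauli_act_def flip_flip_add phase_mult[symmetric] add.commute mult.assoc)

lemma twist1_swap:
  "twist1 w v = cnj (twist1 v w)" "cmod (twist1 v w) = 1"
  "twist1 w v = (if fst v * snd w + snd v * fst w = 0 then 1 else -1) * twist1 v w"
  by (cases v; cases w; cases "fst v"; cases "snd v"; cases "fst w"; cases "snd w";
      simp add: twist1_def)+

lemma twist_cnj: "twist R g f = cnj (twist R f g)"
  by (simp add: twist_def twist1_swap(1)[of "f _"])

lemma cmod_twist [simp]: "cmod (twist R f g) = 1"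
  by (simp add: twist_def twist1_swap(2) flip: prod_norm)

lemma twist_swap:
  assumes "finite R"
  shows "twist R g f = (if omega R f g = 0 then 1 else -1) * twist R f g"
  using assms
proof (induction R rule: finite_induct)
  case (insert q R)
  have *: "omega (insert q R) f g = (fst (f q) * snd (g q) + snd (f q) * fst (g q)) + omega R f g"
    unfolding omega_def by (rule sum.insert[OF insert.hyps])
  have sgn: "(if a + b = 0 then 1 else -1 :: complex) = (if a = 0 then 1 else -1) * (if b = 0 then 1 else -1)"
    for a b :: bit by (cases a; cases b) simp_all
  have ins: "twist (insert q R) f g = twist1 (f q) (g q) * twist R f g" for f g
    unfolding twist_def by (rule prod.insert[OF insert.hyps])
  show ?case
    unfolding * ins sgn[of "fst (f q) * snd (g q) + snd (f q) * fst (g q)"]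
      twist1_swap(3)[where v = "f q" and w = "g q"] insert.IH
    by (simp only: ac_simps)
qed (simp add: twist_def omega_def)

text \<open>Conjugating the phase corresponds to exchanging the two factors, so anticommutation
  makes it purely imaginary, and its modulus is one.\<close>

lemma twist_anticommuting:
  assumes "finite R" "omega R f g = 1"
  shows "twist R f g = \<i> \<or> twist R f g = -\<i>"
proof -
  have c: "cnj (twist R f g) = - twist R f g"
    using twist_swap[OF assms(1), where f = f and g = g] assms(2) by (simp flip: twist_cnj)
  hence "twist R f g * twist R f g = -1"
    using complex_norm_square[of "twist R f g"] by (simp add: minus_equation_iff)
  hence "(twist R f g - \<i>) * (twist R f g + \<i>) = 0"
    by (simp add: algebra_simps)
  thus ?thesis by (auto simp: add_eq_0_iff2)
qed

lemma phase1_zero [simp]: "phase1 (0, 0) b = 1" "phase1 0 b = 1"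
  by (simp_all add: phase1_def sigma1_def zero_prod_def)

lemma phase_zero [simp]: "phase R 0 x = 1"
  by (simp add: phase_def)

lemma pauli_act_zero [simp]: "pauli_act R 0 \<psi> = \<psi>"
  by (simp add: pauli_act_def fun_eq_iff)

lemma twist1_self [simp]: "twist1 v v = 1"
  by (simp only: twist1_def mult.commute[of "snd v"] bit_add_self simp_thms if_True)

lemma twist_self [simp]: "twist R f f = 1"
  by (simp add: twist_def)

lemma pauli_act_self [simp]: "pauli_act R f (pauli_act R f \<psi>) = \<psi>"
  by (simp add: fun_eq_iff pauli_act_mult)

lemma cmod_phase1 [simp]: "cmod (phase1 v b) = 1"
  by (cases v; cases "fst v"; cases "snd v"; simp add: phase1_def sigma1_def)

lemma cmod_phase [simp]: "cmod (phase R f x) = 1"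
  by (simp add: phase_def flip: prod_norm)

text \<open>Hermiticity of Pauli operators: the phases at a label and at its image multiply to one,
  because the square is the identity, and they have modulus one.\<close>

lemma phase_cnj: "cnj (phase R f x) = phase R f (flip f x)"
proof -
  have "phase R f x * phase R f (flip f x) = 1"
    by (simp add: phase_mult)
  moreover have "phase R f x * cnj (phase R f x) = 1"
    using complex_norm_square[of "phase R f x"] by simp
  ultimately show ?thesis
    by (metis mult.commute mult.left_commute mult.right_neutral)
qed

lemma phase_subset:
  assumes "finite Q" "R \<subseteq> Q" "f \<in> Gn R"
  shows "phase Q f x = phase R f (x \<inter> R)"
proof -
  have "phase Q f x = (\<Prod>q\<in>R. phase1 (f q) (q \<in> x))"
    unfolding phase_def by (rule prod.mono_neutral_right) (use assms in \<open>auto simp: Gn_def\<close>)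
  also have "\<dots> = phase R f (x \<inter> R)"
    unfolding phase_def by (intro prod.cong) auto
  finally show ?thesis .
qed

lemma pauli_entry:
  assumes "finite R" "f \<in> Gn R" "x \<subseteq> R" "y \<subseteq> R"
  shows "pauli R f x y = (if y = flip f x then phase R f x else 0)"
proof (cases "y = flip f x")
  case True
  thus ?thesis unfolding pauli_def phase_def phase1_def by (auto simp: flip_def intro!: prod.cong)
next
  case False
  then obtain q where q: "(q \<in> y) \<noteq> (q \<in> flip f x)" by blast
  hence qR: "q \<in> R" using assms flip_in_Pow by blast
  have "sigma1 (f q) (q \<in> x) (q \<in> y) = 0"
    using q by (cases "f q"; cases "fst (f q)"; cases "snd (f q)") (auto simp: flip_def sigma1_def)
  thus ?thesis using False qR assms(1) unfolding pauli_def by (auto intro: prod_zero)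
qed

lemma sum_pauli:
  assumes "finite R" "f \<in> Gn R" "x \<subseteq> R"
  shows "(\<Sum>z\<in>Pow R. pauli R f x z * F z) = phase R f x * F (flip f x)"
proof -
  have "(\<Sum>z\<in>Pow R. pauli R f x z * F z) = (\<Sum>z\<in>Pow R. if z = flip f x then phase R f x * F z else 0)"
    by (intro sum.cong refl) (simp add: pauli_entry assms)
  thus ?thesis using assms by (simp add: flip_in_Pow)
qed

lemma apply_op_pauli:
  assumes "finite R" "f \<in> Gn R" "x \<subseteq> R"
  shows "apply_op R (pauli R f) \<psi> x = pauli_act R f \<psi> x"
  unfolding apply_op_def pauli_act_def by (rule sum_pauli[OF assms])

lemma mmul_pauli:
  assumes "finite R" "f \<in> Gn R" "x \<subseteq> R"
  shows "mmul R (pauli R f) N x y = pauli_act R f (\<lambda>z. N z y) x"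
  unfolding mmul_def pauli_act_def by (rule sum_pauli[OF assms])

section \<open>Rotations and the Clifford gates that implement them\<close>

definition rot :: "'q set \<Rightarrow> complex \<Rightarrow> 'q symp \<Rightarrow> 'q state \<Rightarrow> 'q state" where
  "rot R c h \<psi> x = (\<psi> x + c * pauli_act R h \<psi> x) / sqrt 2"

definition one_op :: "'q op" where
  "one_op x y = (if x = y then 1 else 0)"

text \<open>Matrix form of \<open>rot\<close>. The parameter \<open>c\<close> is \<i> for the gate
  itself and -\<i> for its adjoint.\<close>

definition gate :: "'q set \<Rightarrow> complex \<Rightarrow> 'q symp \<Rightarrow> 'q op" where
  "gate R c h x y = (one_op x y + c * pauli R h x y) / sqrt 2"

lemma pauli_act_cong:
  "h \<in> Gn R \<Longrightarrow> x \<subseteq> R \<Longrightarrow> (\<And>z. z \<subseteq> R \<Longrightarrow> \<psi> z = \<phi> z) \<Longrightarrow> pauli_act R h \<psi> x = pauli_act R h \<phi> x"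
  by (simp add: pauli_act_def flip_in_Pow)

lemma rot_cong:
  "h \<in> Gn R \<Longrightarrow> x \<subseteq> R \<Longrightarrow> (\<And>z. z \<subseteq> R \<Longrightarrow> \<psi> z = \<phi> z) \<Longrightarrow> rot R c h \<psi> x = rot R c h \<phi> x"
  using pauli_act_cong[of h R x \<psi> \<phi>] by (simp add: rot_def)

lemma pauli_act_scale: "pauli_act R h (\<lambda>x. c * \<psi> x) x = c * pauli_act R h \<psi> x"
  by (simp add: pauli_act_def)

lemma rot_scale: "rot R c h (\<lambda>x. d * \<psi> x) x = d * rot R c h \<psi> x"
  by (simp add: rot_def pauli_act_scale algebra_simps)

lemma pauli_act_rot:
  "pauli_act R g (rot R c h \<psi>) x = (pauli_act R g \<psi> x + c * pauli_act R g (pauli_act R h \<psi>) x) / sqrt 2"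
  by (simp add: pauli_act_def rot_def algebra_simps)

lemma sqrt2_mult: "complex_of_real (sqrt 2) * complex_of_real (sqrt 2) = 2"
  by (simp flip: of_real_mult)

text \<open>\<sigma>(h) squares to the identity, so composites stay in the span of 1 and
  \<sigma>(h). The values \<i> and -\<i> yield the identity, and \<i> taken twice yields \<i>
  \<sigma>(h).\<close>

lemma rot_rot:
  "rot R c h (rot R d h \<psi>) x = ((1 + c * d) * \<psi> x + (c + d) * pauli_act R h \<psi> x) / 2"
proof -
  have "rot R c h (rot R d h \<psi>) x =
      ((\<psi> x + d * pauli_act R h \<psi> x) + c * (pauli_act R h \<psi> x + d * \<psi> x)) /
      (complex_of_real (sqrt 2) * complex_of_real (sqrt 2))"
    by (simp add: rot_def[of R c h] pauli_act_rot) (simp add: rot_def add_divide_distrib)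
  thus ?thesis by (simp only: sqrt2_mult) (simp add: algebra_simps)
qed

lemma rot_twice: "rot R \<i> h (rot R \<i> h \<psi>) = (\<lambda>x. \<i> * pauli_act R h \<psi> x)"
  by (simp add: fun_eq_iff rot_rot)

lemma twist_add_self: "twist R (f + h) h = twist R h f"
proof -
  have "twist1 (v + w) w = twist1 w v" for v w
    by (cases v; cases w; cases "fst v"; cases "snd v"; cases "fst w"; cases "snd w";
        simp add: twist1_def)
  thus ?thesis by (simp add: twist_def)
qed

text \<open>For commuting operators nothing changes. For anticommuting ones, conjugating \<sigma>(f)
  by the gate gives \<i> \<sigma>(h) \<sigma>(f), that is, \<i> \<open>twist R h f\<close> times
  \<sigma>(f + h); the twist is \<i> or -\<i>, so the factor is a sign. It depends neither on the
  state nor on the label.\<close>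

lemma rot_pauli_act:
  assumes fin: "finite R"
  obtains s :: complex where "s = 1 \<or> s = -1"
    "\<And>\<psi> x. rot R \<i> h (pauli_act R f \<psi>) x = s * pauli_act R (trv R h f) (rot R \<i> h \<psi>) x"
proof (cases "omega R f h = 0")
  case True
  have "twist R h f = twist R f h"
    using twist_swap[OF fin, where f = f and g = h] True by simp
  hence "rot R \<i> h (pauli_act R f \<psi>) x = 1 * pauli_act R (trv R h f) (rot R \<i> h \<psi>) x" for \<psi> x
    using True by (simp add: rot_def[of R _ h "pauli_act R f \<psi>"] pauli_act_rot trv_def pauli_act_mult add.commute)
  thus ?thesis using that[of 1] by blast
next
  case False
  let ?s = "\<i> * twist R h f"
  have t: "twist R h f = \<i> \<or> twist R h f = -\<i>"
    using twist_anticommuting[OF fin, of h f] False by (simp add: omega_commute)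
  have "rot R \<i> h (pauli_act R f \<psi>) x = ?s * pauli_act R (trv R h f) (rot R \<i> h \<psi>) x" for \<psi> x
  proof -
    have "pauli_act R (trv R h f) (rot R \<i> h \<psi>) x =
        (pauli_act R (f + h) \<psi> x + \<i> * (twist R h f * pauli_act R f \<psi> x)) / sqrt 2"
      using False by (simp add: trv_def pauli_act_rot pauli_act_mult twist_add_self add.assoc)
    moreover have "rot R \<i> h (pauli_act R f \<psi>) x =
        (pauli_act R f \<psi> x + \<i> * (twist R h f * pauli_act R (f + h) \<psi> x)) / sqrt 2"
      by (simp add: rot_def pauli_act_mult add.commute)
    ultimately show ?thesis using t by auto
  qed
  moreover have "?s = 1 \<or> ?s = -1" using t by auto
  ultimately show ?thesis using that[of ?s] by blast
qed

text \<open>Operators are functions of arbitrary labels, but only entries indexed by subsets of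
  \<open>R\<close> are meaningful.\<close>

definition op_eq :: "'q set \<Rightarrow> 'q op \<Rightarrow> 'q op \<Rightarrow> bool" where
  "op_eq R A B \<longleftrightarrow> (\<forall>x\<in>Pow R. \<forall>y\<in>Pow R. A x y = B x y)"

lemma op_eq_mmul: "op_eq R A A' \<Longrightarrow> op_eq R B B' \<Longrightarrow> op_eq R (mmul R A B) (mmul R A' B')"
  by (simp add: op_eq_def mmul_def)

lemma op_eq_refl: "op_eq R A A"
  by (simp add: op_eq_def)

lemma op_eq_trans: "op_eq R A B \<Longrightarrow> op_eq R B C \<Longrightarrow> op_eq R A C"
  by (simp add: op_eq_def)

lemma mmul_assoc: "mmul R (mmul R A B) C = mmul R A (mmul R B C)"
proof (intro ext)
  fix x y
  have "mmul R (mmul R A B) C x y = (\<Sum>z\<in>Pow R. \<Sum>w\<in>Pow R. A x w * B w z * C z y)"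
    by (simp add: mmul_def sum_distrib_right)
  also have "\<dots> = (\<Sum>w\<in>Pow R. \<Sum>z\<in>Pow R. A x w * B w z * C z y)" by (rule sum.swap)
  also have "\<dots> = mmul R A (mmul R B C) x y"
    by (simp add: mmul_def sum_distrib_left mult.assoc)
  finally show "mmul R (mmul R A B) C x y = mmul R A (mmul R B C) x y" .
qed

lemma adj_mmul: "adj (mmul R A B) = mmul R (adj B) (adj A)"
  by (simp add: fun_eq_iff adj_def mmul_def mult.commute)

lemma op_eq_one_mmul: "finite R \<Longrightarrow> op_eq R (mmul R one_op A) A"
  by (auto simp: op_eq_def mmul_def one_op_def if_distrib[of "\<lambda>u. u * _"] cong: if_cong)

lemma unitary_op_eq:
  "unitary_op R U \<longleftrightarrow> op_eq R (mmul R U (adj U)) one_op \<and> op_eq R (mmul R (adj U) U) one_op"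
  unfolding unitary_op_def op_eq_def one_op_def by blast

lemma unitary_op_mmul:
  assumes fin: "finite R" and U: "unitary_op R U" and V: "unitary_op R V"
  shows "unitary_op R (mmul R U V)"
proof -
  have key: "op_eq R (mmul R (mmul R A B) (mmul R B' A')) one_op"
    if "op_eq R (mmul R A A') one_op" "op_eq R (mmul R B B') one_op" for A A' B B'
  proof -
    have "op_eq R (mmul R A (mmul R (mmul R B B') A')) (mmul R A (mmul R one_op A'))"
      by (intro op_eq_mmul op_eq_refl that)
    moreover have "op_eq R (mmul R A (mmul R one_op A')) (mmul R A A')"
      by (intro op_eq_mmul op_eq_refl op_eq_one_mmul fin)
    ultimately show ?thesis
      using that(1) by (simp add: mmul_assoc op_eq_def)
  qed
  show ?thesis
    using U V unfolding unitary_op_eq adj_mmul by (auto intro: key)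
qed

lemma clifford_op_eq:
  "clifford R U \<longleftrightarrow> unitary_op R U \<and> (\<exists>u. \<forall>f\<in>Gn R. u f \<in> Gn R \<and> (\<exists>s::complex. (s = 1 \<or> s = -1) \<and>
     op_eq R (mmul R (mmul R U (pauli R f)) (adj U)) (\<lambda>x y. s * pauli R (u f) x y)))"
  unfolding clifford_def op_eq_def by blast

lemma clifford_mmul:
  assumes fin: "finite R" and U: "clifford R U" and V: "clifford R V"
  shows "clifford R (mmul R U V)"
proof -
  obtain u where u: "\<And>f. f \<in> Gn R \<Longrightarrow> u f \<in> Gn R \<and> (\<exists>s::complex. (s = 1 \<or> s = -1) \<and>
     op_eq R (mmul R (mmul R U (pauli R f)) (adj U)) (\<lambda>x y. s * pauli R (u f) x y))"
    using U unfolding clifford_op_eq by blast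
  obtain v where v: "\<And>f. f \<in> Gn R \<Longrightarrow> v f \<in> Gn R \<and> (\<exists>s::complex. (s = 1 \<or> s = -1) \<and>
     op_eq R (mmul R (mmul R V (pauli R f)) (adj V)) (\<lambda>x y. s * pauli R (v f) x y))"
    using V unfolding clifford_op_eq by blast
  have "u (v f) \<in> Gn R \<and> (\<exists>s::complex. (s = 1 \<or> s = -1) \<and>
     op_eq R (mmul R (mmul R (mmul R U V) (pauli R f)) (adj (mmul R U V))) (\<lambda>x y. s * pauli R (u (v f)) x y))"
    if f: "f \<in> Gn R" for f
  proof -
    obtain s where s: "s = 1 \<or> s = -1" and
      1: "op_eq R (mmul R (mmul R V (pauli R f)) (adj V)) (\<lambda>x y. s * pauli R (v f) x y)"
      using v[OF f] by blast
    obtain t where t: "t = 1 \<or> t = -1" and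
      2: "op_eq R (mmul R (mmul R U (pauli R (v f))) (adj U)) (\<lambda>x y. t * pauli R (u (v f)) x y)"
      using u[of "v f"] v[OF f] by blast
    have 3: "op_eq R (mmul R (mmul R U (mmul R (mmul R V (pauli R f)) (adj V))) (adj U))
        (mmul R (mmul R U (\<lambda>x y. s * pauli R (v f) x y)) (adj U))"
      by (intro op_eq_mmul op_eq_refl 1)
    have 4: "mmul R (mmul R U (\<lambda>x y. s * pauli R (v f) x y)) (adj U) =
        (\<lambda>x y. s * mmul R (mmul R U (pauli R (v f))) (adj U) x y)"
      by (simp add: mmul_def fun_eq_iff sum_distrib_left sum_distrib_right ac_simps)
    have "op_eq R (mmul R (mmul R (mmul R U V) (pauli R f)) (adj (mmul R U V)))
        (\<lambda>x y. (s * t) * pauli R (u (v f)) x y)"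
      using 2 3 unfolding 4 by (simp add: adj_mmul mmul_assoc op_eq_def)
    moreover have "s * t = 1 \<or> s * t = -1" using s t by auto
    ultimately show ?thesis using u v f by blast
  qed
  moreover have "unitary_op R (mmul R U V)"
    using unitary_op_mmul[OF fin] U V unfolding clifford_op_eq by blast
  ultimately show ?thesis unfolding clifford_op_eq by (intro conjI exI[of _ "\<lambda>f. u (v f)"]) auto
qed

lemma pauli_act_one_op:
  "finite R \<Longrightarrow> h \<in> Gn R \<Longrightarrow> x \<subseteq> R \<Longrightarrow> y \<subseteq> R \<Longrightarrow> pauli_act R h (\<lambda>z. one_op z y) x = pauli R h x y"
  by (auto simp: pauli_act_def one_op_def pauli_entry)

text \<open>A matrix column is read as a state, here column \<open>y\<close> of the identity; matrix
  identities for gates then follow from identities for \<open>rot\<close>.\<close>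

lemma gate_eq_rot:
  "finite R \<Longrightarrow> h \<in> Gn R \<Longrightarrow> x \<subseteq> R \<Longrightarrow> y \<subseteq> R \<Longrightarrow> gate R c h x y = rot R c h (\<lambda>z. one_op z y) x"
  by (simp add: gate_def rot_def pauli_act_one_op)

lemma mmul_gate:
  assumes "finite R" "h \<in> Gn R" "x \<subseteq> R"
  shows "mmul R (gate R c h) N x y = rot R c h (\<lambda>z. N z y) x"
proof -
  have "mmul R (gate R c h) N x y =
      ((\<Sum>z\<in>Pow R. one_op x z * N z y) + c * (\<Sum>z\<in>Pow R. pauli R h x z * N z y)) / sqrt 2"
    by (simp add: mmul_def gate_def sum_divide_distrib sum_distrib_left algebra_simps
        flip: sum.distrib add_divide_distrib)
  also have "(\<Sum>z\<in>Pow R. one_op x z * N z y) = N x y"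
    using assms by (simp add: one_op_def if_distrib[of "\<lambda>u. u * _"] cong: if_cong)
  finally show ?thesis using assms by (simp add: sum_pauli rot_def pauli_act_def)
qed

lemma pauli_hermitian:
  assumes "finite R" "h \<in> Gn R" "x \<subseteq> R" "y \<subseteq> R"
  shows "cnj (pauli R h y x) = pauli R h x y"
  using assms by (auto simp: pauli_entry phase_cnj)

lemma adj_gate: "finite R \<Longrightarrow> h \<in> Gn R \<Longrightarrow> op_eq R (adj (gate R c h)) (gate R (cnj c) h)"
  by (auto simp: op_eq_def adj_def gate_def one_op_def pauli_hermitian)

lemma gate_mmul_gate:
  assumes fin: "finite R" and h: "h \<in> Gn R" and c: "c * d = 1" "c + d = 0"
  shows "op_eq R (mmul R (gate R c h) (gate R d h)) one_op"
proof -
  have "mmul R (gate R c h) (gate R d h) x y = one_op x y" if "x \<subseteq> R" "y \<subseteq> R" for x y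
  proof -
    have "mmul R (gate R c h) (gate R d h) x y = rot R c h (rot R d h (\<lambda>z. one_op z y)) x"
      using that by (subst mmul_gate[OF fin h that(1)]) (intro rot_cong h gate_eq_rot fin; simp)
    also have "\<dots> = one_op x y" by (simp add: rot_rot c)
    finally show ?thesis .
  qed
  thus ?thesis by (simp add: op_eq_def)
qed

text \<open>The symplectic action is the transvection, and the sign from
  \<open>rot_pauli_act\<close> is the one allowed in a Clifford operator. Once the Pauli has been
  moved past the gate, the gate cancels against its adjoint.\<close>

lemma clifford_gate:
  assumes fin: "finite R" and h: "h \<in> Gn R"
  shows "clifford R (gate R \<i> h)"
  unfolding clifford_op_eq
proof (intro conjI exI[of _ "trv R h"] ballI)
  let ?U = "gate R \<i> h" and ?V = "gate R (-\<i>) h"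
  have adj: "op_eq R (adj ?U) ?V" using adj_gate[OF fin h, of \<i>] by simp
  show "unitary_op R ?U"
    unfolding unitary_op_eq
    using op_eq_mmul[OF op_eq_refl adj, of ?U] op_eq_mmul[OF adj op_eq_refl, of ?U]
      gate_mmul_gate[OF fin h, of \<i> "-\<i>"] gate_mmul_gate[OF fin h, of "-\<i>" \<i>]
    by (auto intro: op_eq_trans)
  fix f :: "'a symp" assume f: "f \<in> Gn R"
  show trv: "trv R h f \<in> Gn R" by (rule trv_in_Gn[OF h f])
  obtain s :: complex where s: "s = 1 \<or> s = -1"
    "\<And>\<psi> x. rot R \<i> h (pauli_act R f \<psi>) x = s * pauli_act R (trv R h f) (rot R \<i> h \<psi>) x"
    using rot_pauli_act[OF fin] by metis
  have "mmul R (mmul R ?U (pauli R f)) ?V x y = s * pauli R (trv R h f) x y"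
    if "x \<subseteq> R" "y \<subseteq> R" for x y
  proof -
    have "mmul R (mmul R ?U (pauli R f)) ?V x y = rot R \<i> h (\<lambda>z. mmul R (pauli R f) ?V z y) x"
      unfolding mmul_assoc using that by (intro mmul_gate fin h)
    also have "\<dots> = rot R \<i> h (pauli_act R f (rot R (-\<i>) h (\<lambda>z. one_op z y))) x"
    proof (rule rot_cong[OF h that(1)])
      fix z assume z: "z \<subseteq> R"
      show "mmul R (pauli R f) ?V z y = pauli_act R f (rot R (-\<i>) h (\<lambda>z. one_op z y)) z"
        using that by (subst mmul_pauli[OF fin f z]) (intro pauli_act_cong f z gate_eq_rot fin h; simp)
    qed
    also have "\<dots> = s * pauli_act R (trv R h f) (rot R \<i> h (rot R (-\<i>) h (\<lambda>z. one_op z y))) x"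
      by (rule s(2))
    also have "rot R \<i> h (rot R (-\<i>) h (\<lambda>z. one_op z y)) = (\<lambda>z. one_op z y)"
      by (simp add: fun_eq_iff rot_rot)
    finally show ?thesis using that by (simp add: pauli_act_one_op fin trv)
  qed
  hence "op_eq R (mmul R (mmul R ?U (pauli R f)) ?V) (\<lambda>x y. s * pauli R (trv R h f) x y)"
    by (simp add: op_eq_def)
  hence "op_eq R (mmul R (mmul R ?U (pauli R f)) (adj ?U)) (\<lambda>x y. s * pauli R (trv R h f) x y)"
    using op_eq_mmul[OF op_eq_refl adj] op_eq_trans by blast
  thus "\<exists>s::complex. (s = 1 \<or> s = -1) \<and>
     op_eq R (mmul R (mmul R ?U (pauli R f)) (adj ?U)) (\<lambda>x y. s * pauli R (trv R h f) x y)"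
    using s(1) by blast
qed

lemma clifford_one_op:
  assumes "finite R"
  shows "clifford R one_op"
proof -
  have adj1: "adj one_op = one_op" by (auto simp: adj_def one_op_def fun_eq_iff)
  have "op_eq R (mmul R (mmul R one_op A) one_op) A" for A
  proof -
    have "mmul R A one_op x y = A x y" if "y \<subseteq> R" for x y
      using that assms by (simp add: mmul_def one_op_def if_distrib[of "\<lambda>u. _ * u"] cong: if_cong)
    thus ?thesis using op_eq_one_mmul[OF assms, of "mmul R A one_op"]
      by (simp add: op_eq_def mmul_assoc)
  qed
  moreover have "op_eq R (mmul R one_op one_op) one_op" by (rule op_eq_one_mmul[OF assms])
  ultimately show ?thesis
    unfolding clifford_op_eq unitary_op_eq adj1
    by (intro conjI exI[of _ id] ballI) (auto intro!: exI[of _ 1])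
qed

subsection \<open>Local Clifford circuits acting on stabilizer states\<close>

definition rots :: "'q set \<Rightarrow> 'q symp list \<Rightarrow> 'q state \<Rightarrow> 'q state" where
  "rots Q = fold (rot Q \<i>)"

lemma rots_simps [simp]:
  "rots Q [] \<psi> = \<psi>" "rots Q (h # hs) \<psi> = rots Q hs (rot Q \<i> h \<psi>)"
  "rots Q (hs @ ks) \<psi> = rots Q ks (rots Q hs \<psi>)"
  by (simp_all add: rots_def)

text \<open>\<open>h\<close> changes only the part of a label that belongs to \<alpha>, and its
  phase depends on that part alone. The other tensor factors are common factors, so a gate on one
  factor rotates the whole state.\<close>

lemma local_op_gate:
  assumes fin: "finite Q" and h: "h \<in> Gn (qubits_of Q pty \<alpha>)" and x: "x \<subseteq> Q"
  shows "local_op Q pty (U(\<alpha> := mmul (qubits_of Q pty \<alpha>) (gate (qubits_of Q pty \<alpha>) \<i> h) (U \<alpha>))) x y =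
    rot Q \<i> h (\<lambda>z. local_op Q pty U z y) x"
proof -
  let ?R = "qubits_of Q pty"
  have finU: "finite (UNIV :: party set)" by (simp add: UNIV_party)
  have finR: "finite (?R \<alpha>)" using fin by (simp add: qubits_of_def)
  define rest where "rest z = (\<Prod>\<beta>\<in>UNIV - {\<alpha>}. U \<beta> (z \<inter> ?R \<beta>) (y \<inter> ?R \<beta>))" for z
  have split: "local_op Q pty V z y = V \<alpha> (z \<inter> ?R \<alpha>) (y \<inter> ?R \<alpha>) * rest z"
    if "\<And>\<beta>. \<beta> \<noteq> \<alpha> \<Longrightarrow> V \<beta> = U \<beta>" for V z
    unfolding local_op_def rest_def by (subst prod.remove[OF finU UNIV_I[of \<alpha>]]) (simp add: that)
  have flip_other: "flip h x \<inter> ?R \<beta> = x \<inter> ?R \<beta>" if "\<beta> \<noteq> \<alpha>" for \<beta>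
    using h that by (auto simp: flip_def Gn_def qubits_of_def)
  have flip_same: "flip h x \<inter> ?R \<alpha> = flip h (x \<inter> ?R \<alpha>)"
    using h by (auto simp: flip_def Gn_def)
  have "rest (flip h x) = rest x"
    unfolding rest_def by (intro prod.cong) (auto simp: flip_other)
  moreover have "local_op Q pty (U(\<alpha> := mmul (?R \<alpha>) (gate (?R \<alpha>) \<i> h) (U \<alpha>))) x y =
      rot (?R \<alpha>) \<i> h (\<lambda>z. U \<alpha> z (y \<inter> ?R \<alpha>)) (x \<inter> ?R \<alpha>) * rest x"
    by (subst split) (simp_all add: mmul_gate[OF finR h])
  moreover have "phase Q h x = phase (?R \<alpha>) h (x \<inter> ?R \<alpha>)"
    by (rule phase_subset[OF fin qubits_of_subset h])
  ultimately show ?thesis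
    by (simp add: rot_def pauli_act_def split[of U] flip_same field_simps)
qed

lemma rot_apply_op: "rot Q c h (apply_op Q M \<psi>) x = (\<Sum>y\<in>Pow Q. rot Q c h (\<lambda>z. M z y) x * \<psi> y)"
  by (simp add: rot_def pauli_act_def apply_op_def sum_distrib_left sum_divide_distrib
      add_divide_distrib algebra_simps flip: sum.distrib)

text \<open>One Clifford operator per party serves all states at once. The induction runs from the
  end of the list because the last gate is multiplied on the left.\<close>

lemma rots_local_clifford:
  assumes fin: "finite Q" and hs: "\<forall>h\<in>set hs. party_local Q pty h"
  obtains U where "\<And>\<alpha>. clifford (qubits_of Q pty \<alpha>) (U \<alpha>)"
    "\<And>\<psi> x. x \<subseteq> Q \<Longrightarrow> apply_op Q (local_op Q pty U) \<psi> x = rots Q hs \<psi> x"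
proof -
  let ?R = "qubits_of Q pty"
  have finR: "finite (?R \<alpha>)" for \<alpha> using fin by (simp add: qubits_of_def)
  have "\<exists>U. (\<forall>\<alpha>. clifford (?R \<alpha>) (U \<alpha>)) \<and> (\<forall>\<psi> x. x \<subseteq> Q \<longrightarrow> apply_op Q (local_op Q pty U) \<psi> x = rots Q hs \<psi> x)"
    using hs
  proof (induction hs rule: rev_induct)
    case Nil
    have "apply_op Q (local_op Q pty (\<lambda>_. one_op)) \<psi> x = \<psi> x" if x: "x \<subseteq> Q" for \<psi> x
    proof -
      have "local_op Q pty (\<lambda>_. one_op) x y = one_op x y" if y: "y \<subseteq> Q" for y
      proof (cases "x = y")
        case True
        thus ?thesis by (simp add: local_op_def one_op_def)
      next
        case False
        then obtain q where q: "(q \<in> x) \<noteq> (q \<in> y)" by blast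
        hence "x \<inter> ?R (pty q) \<noteq> y \<inter> ?R (pty q)" using x y by (auto simp: qubits_of_def)
        hence "\<exists>\<alpha>. one_op (x \<inter> ?R \<alpha>) (y \<inter> ?R \<alpha>) = 0" by (auto simp: one_op_def)
        moreover have "finite (UNIV :: party set)" by (simp add: UNIV_party)
        ultimately show ?thesis using False by (auto simp: local_op_def one_op_def intro!: prod_zero)
      qed
      hence "apply_op Q (local_op Q pty (\<lambda>_. one_op)) \<psi> x = (\<Sum>y\<in>Pow Q. one_op x y * \<psi> y)"
        by (simp add: apply_op_def)
      thus ?thesis using fin x by (simp add: one_op_def if_distrib[of "\<lambda>u. u * _"] cong: if_cong)
    qed
    thus ?case using clifford_one_op[OF finR] by (intro exI[of _ "\<lambda>_. one_op"]) simp
  next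
    case (snoc h hs)
    then obtain U where U: "\<And>\<alpha>. clifford (?R \<alpha>) (U \<alpha>)"
      "\<And>\<psi> x. x \<subseteq> Q \<Longrightarrow> apply_op Q (local_op Q pty U) \<psi> x = rots Q hs \<psi> x" by auto
    obtain \<alpha> where h: "h \<in> Gn (?R \<alpha>)" using snoc.prems by (auto simp: party_local_def)
    let ?U = "U(\<alpha> := mmul (?R \<alpha>) (gate (?R \<alpha>) \<i> h) (U \<alpha>))"
    have hQ: "h \<in> Gn Q" using h Gn_mono[OF qubits_of_subset] by blast
    have "apply_op Q (local_op Q pty ?U) \<psi> x = rots Q (hs @ [h]) \<psi> x" if x: "x \<subseteq> Q" for \<psi> x
    proof -
      have "apply_op Q (local_op Q pty ?U) \<psi> x = (\<Sum>y\<in>Pow Q. rot Q \<i> h (\<lambda>z. local_op Q pty U z y) x * \<psi> y)"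
        unfolding apply_op_def by (simp only: local_op_gate[OF fin h x])
      also have "\<dots> = rot Q \<i> h (apply_op Q (local_op Q pty U) \<psi>) x"
        by (rule rot_apply_op[symmetric])
      also have "\<dots> = rot Q \<i> h (rots Q hs \<psi>) x"
        by (rule rot_cong[OF hQ x U(2)])
      finally show ?thesis by simp
    qed
    moreover have "clifford (?R \<beta>) (?U \<beta>)" for \<beta>
      using U(1) clifford_mmul[OF finR clifford_gate[OF finR h] U(1)] by simp
    ultimately show ?case by blast
  qed
  thus ?thesis using that by blast
qed

section \<open>Norms, stabilizers and Pauli corrections under rotations\<close>

lemma sum_Pow_flip:
  assumes "h \<in> Gn R"
  shows "(\<Sum>x\<in>Pow R. F (flip h x)) = (\<Sum>x\<in>Pow R. F x)"
  by (rule sum.reindex_bij_witness[of _ "flip h" "flip h"]) (use flip_in_Pow[OF assms] in auto)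

lemma cmod_add_i_mult_sq:
  "(cmod ((a + \<i> * b) / sqrt 2))\<^sup>2 = (cmod a)\<^sup>2 / 2 + (cmod b)\<^sup>2 / 2 - Im (cnj a * b)"
proof -
  have "(cmod ((a + \<i> * b) / sqrt 2))\<^sup>2 = (cmod (a + \<i> * b))\<^sup>2 / 2"
    by (simp add: norm_divide power_divide)
  thus ?thesis unfolding cmod_power2 by (simp add: power2_eq_square field_simps)
qed

text \<open>The cross term is the imaginary part of the expectation value of \<sigma>(h). That value
  is real, since flipping a label conjugates its summand; the other two terms contribute half the
  norm each.\<close>

lemma unit_state_rot:
  assumes h: "h \<in> Gn Q" and \<psi>: "unit_state Q \<psi>"
  shows "unit_state Q (rot Q \<i> h \<psi>)"
proof -
  define A where "A x = cnj (\<psi> x) * pauli_act Q h \<psi> x" for x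
  have "A (flip h x) = cnj (A x)" for x
    by (simp add: A_def pauli_act_def phase_cnj mult_ac)
  hence "(\<Sum>x\<in>Pow Q. cnj (A x)) = (\<Sum>x\<in>Pow Q. A x)"
    using sum_Pow_flip[OF h, of A] by simp
  hence real: "Im (\<Sum>x\<in>Pow Q. A x) = 0"
    by (metis cnj_sum Reals_cnj_iff complex_is_Real_iff)
  have "(cmod (rot Q \<i> h \<psi> x))\<^sup>2 =
      (cmod (\<psi> x))\<^sup>2 / 2 + (cmod (pauli_act Q h \<psi> x))\<^sup>2 / 2 - Im (A x)" for x
    unfolding rot_def A_def by (rule cmod_add_i_mult_sq)
  hence "(\<Sum>x\<in>Pow Q. (cmod (rot Q \<i> h \<psi> x))\<^sup>2) =
      (\<Sum>x\<in>Pow Q. (cmod (\<psi> x))\<^sup>2) / 2 + (\<Sum>x\<in>Pow Q. (cmod (pauli_act Q h \<psi> x))\<^sup>2) / 2"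
    using real by (simp add: sum.distrib sum_subtractf sum_divide_distrib)
  also have "(\<Sum>x\<in>Pow Q. (cmod (pauli_act Q h \<psi> x))\<^sup>2) = (\<Sum>x\<in>Pow Q. (cmod (\<psi> x))\<^sup>2)"
    using sum_Pow_flip[OF h, of "\<lambda>x. (cmod (\<psi> x))\<^sup>2"] by (simp add: pauli_act_def norm_mult)
  finally show ?thesis using \<psi> by (simp add: unit_state_def)
qed

lemma unit_state_rots:
  "set hs \<subseteq> Gn Q \<Longrightarrow> unit_state Q \<psi> \<Longrightarrow> unit_state Q (rots Q hs \<psi>)"
  by (induction hs arbitrary: \<psi>) (simp_all add: unit_state_rot)

text \<open>The sign of each element is existentially quantified: a rotation may change it by a
  factor 1 or -1 without this being recorded.\<close>

definition stabilized :: "'q set \<Rightarrow> 'q symp set \<Rightarrow> 'q state \<Rightarrow> bool" where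
  "stabilized Q S \<psi> \<longleftrightarrow> (\<forall>f\<in>S. \<exists>e::complex. (e = 1 \<or> e = -1) \<and>
     (\<forall>x. x \<subseteq> Q \<longrightarrow> pauli_act Q f \<psi> x = e * \<psi> x))"

lemma stabilized_rot:
  assumes fin: "finite Q" and h: "h \<in> Gn Q" and st: "stabilized Q S \<psi>"
  shows "stabilized Q (trv Q h ` S) (rot Q \<i> h \<psi>)"
  unfolding stabilized_def
proof (clarify)
  fix f assume "f \<in> S"
  then obtain e :: complex where e: "e = 1 \<or> e = -1"
    "\<And>x. x \<subseteq> Q \<Longrightarrow> pauli_act Q f \<psi> x = e * \<psi> x"
    using st unfolding stabilized_def by blast
  obtain s :: complex where s: "s = 1 \<or> s = -1"
    "\<And>\<psi> x. rot Q \<i> h (pauli_act Q f \<psi>) x = s * pauli_act Q (trv Q h f) (rot Q \<i> h \<psi>) x"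
    using rot_pauli_act[OF fin] by metis
  have "pauli_act Q (trv Q h f) (rot Q \<i> h \<psi>) x = (s * e) * rot Q \<i> h \<psi> x" if x: "x \<subseteq> Q" for x
  proof -
    have "pauli_act Q (trv Q h f) (rot Q \<i> h \<psi>) x = s * rot Q \<i> h (pauli_act Q f \<psi>) x"
      using s by auto
    also have "rot Q \<i> h (pauli_act Q f \<psi>) x = rot Q \<i> h (\<lambda>x. e * \<psi> x) x"
      by (rule rot_cong[OF h x e(2)])
    finally show ?thesis by (simp add: rot_scale)
  qed
  moreover have "s * e = 1 \<or> s * e = -1" using s e by auto
  ultimately show "\<exists>e. (e = 1 \<or> e = -1) \<and>
      (\<forall>x. x \<subseteq> Q \<longrightarrow> pauli_act Q (trv Q h f) (rot Q \<i> h \<psi>) x = e * rot Q \<i> h \<psi> x)"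
    by blast
qed

lemma stabilized_rots:
  assumes "finite Q" "set hs \<subseteq> Gn Q" "stabilized Q S \<psi>"
  shows "stabilized Q (trvs Q hs ` S) (rots Q hs \<psi>)"
  using assms(2,3)
proof (induction hs arbitrary: S \<psi>)
  case (Cons h hs)
  hence "stabilized Q (trvs Q hs ` (trv Q h ` S)) (rots Q hs (rot Q \<i> h \<psi>))"
    by (intro Cons.IH stabilized_rot assms) auto
  thus ?case by (simp add: image_image)
qed simp

text \<open>Two equal rotations compose to \<i> times a Pauli operator. Up to twists \<sigma>(h) is
  the product of its parts at the three parties, so doubling the rotation of each part realizes it
  by local gates.\<close>

lemma pauli_act_rots:
  assumes fin: "finite Q" and h: "h \<in> Gn Q"
  obtains hs c where "\<forall>h\<in>set hs. party_local Q pty h" "cmod c = 1"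
    "\<And>\<psi> x. rots Q hs \<psi> x = c * pauli_act Q h \<psi> x"
proof -
  let ?R = "\<lambda>\<alpha>. restr (qubits_of Q pty \<alpha>) h"
  let ?a = "?R PA" and ?b = "?R PB" and ?c = "?R PC"
  have hsum: "?c + (?b + ?a) = h"
  proof
    fix q
    show "(?c + (?b + ?a)) q = h q"
      using h by (cases "pty q") (auto simp: restr_apply qubits_of_def Gn_def)
  qed
  have uminus: "pauli_act Q g (\<lambda>x. - \<psi> x) x = - pauli_act Q g \<psi> x" for g \<psi> x
    by (simp add: pauli_act_def)
  \<comment> \<open>The three doubled rotations contribute \<open>\<i> ^ 3\<close>, which is -\<i>;
    the twists come from multiplying the three parts.\<close>
  have "rots Q [?a, ?a, ?b, ?b, ?c, ?c] \<psi> x =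
      (- \<i> * (twist Q ?b ?a * twist Q ?c (?b + ?a))) * pauli_act Q (?c + (?b + ?a)) \<psi> x" for \<psi> x
    by (simp add: rot_twice pauli_act_scale[abs_def] pauli_act_mult[abs_def] pauli_act_scale pauli_act_mult uminus)
  moreover have "cmod (- \<i> * (twist Q ?b ?a * twist Q ?c (?b + ?a))) = 1"
    by (simp add: norm_mult)
  moreover have "party_local Q pty (?R \<alpha>)" for \<alpha>
    unfolding party_local_def by (rule exI[of _ \<alpha>]) (rule restr_in_Gn)
  hence "\<forall>h\<in>set [?a, ?a, ?b, ?b, ?c, ?c]. party_local Q pty h" by simp
  ultimately show ?thesis using that unfolding hsum by blast
qed

lemma pauli_act_swap:
  assumes "finite Q"
  shows "pauli_act Q f (pauli_act Q h \<psi>) x =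
    (if omega Q f h = 0 then 1 else -1) * pauli_act Q h (pauli_act Q f \<psi>) x"
  using twist_swap[OF assms, where f = h and g = f]
  by (simp add: pauli_act_mult omega_commute[of Q f h] add.commute)

text \<open>The mechanism of sign correction: eigenvalues are negated exactly for the elements that
  anticommute with \<open>h\<close>.\<close>

lemma stabilized_pauli_act:
  assumes fin: "finite Q" and h: "h \<in> Gn Q"
    and e: "\<And>x. x \<subseteq> Q \<Longrightarrow> pauli_act Q f \<psi> x = e * \<psi> x" and x: "x \<subseteq> Q"
  shows "pauli_act Q f (pauli_act Q h \<psi>) x = ((if omega Q f h = 0 then 1 else -1) * e) * pauli_act Q h \<psi> x"
proof -
  have "pauli_act Q h (pauli_act Q f \<psi>) x = pauli_act Q h (\<lambda>x. e * \<psi> x) x"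
    by (rule pauli_act_cong[OF h x e])
  thus ?thesis by (simp add: pauli_act_swap[OF fin, of f h] pauli_act_scale)
qed

section \<open>Block products as stabilized states\<close>

lemma block_partition_disj:
  "block_partition Q P \<Longrightarrow> b \<in> P \<Longrightarrow> b' \<in> P \<Longrightarrow> q \<in> b \<Longrightarrow> q \<in> b' \<Longrightarrow> b = b'"
  unfolding block_partition_def by blast

lemma block_partition_subset: "block_partition Q P \<Longrightarrow> b \<in> P \<Longrightarrow> b \<subseteq> Q"
  unfolding block_partition_def by blast

lemma finite_block_partition: "finite Q \<Longrightarrow> block_partition Q P \<Longrightarrow> finite P"
  unfolding block_partition_def using finite_UnionD by blast

text \<open>These labels are the support of the block product: being constant on each block, such a
  label amounts to a choice of the blocks set to one.\<close>

lemma unions_of_blocks: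
  assumes P: "block_partition Q P"
  shows "{x \<in> Pow Q. \<forall>b\<in>P. x \<inter> b = {} \<or> b \<subseteq> x} = Union ` Pow P"
proof (intro set_eqI iffI)
  fix x assume x: "x \<in> {x \<in> Pow Q. \<forall>b\<in>P. x \<inter> b = {} \<or> b \<subseteq> x}"
  have "q \<in> \<Union>{b \<in> P. b \<subseteq> x}" if "q \<in> x" for q
  proof -
    have "x \<subseteq> \<Union>P" using x P by (simp add: block_partition_def)
    hence "q \<in> \<Union>P" using that by blast
    then obtain b where "b \<in> P" "q \<in> b" by blast
    moreover from this x have "x \<inter> b = {} \<or> b \<subseteq> x" by simp
    ultimately show ?thesis using that by blast
  qed
  hence "x = \<Union>{b \<in> P. b \<subseteq> x}" by blast
  thus "x \<in> Union ` Pow P" by blast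
next
  fix x assume "x \<in> Union ` Pow P"
  then obtain P' where x: "x = \<Union>P'" "P' \<subseteq> P" by blast
  have "x \<inter> b = {} \<or> b \<subseteq> x" if "b \<in> P" for b
  proof (cases "b \<in> P'")
    case False
    hence "b' \<inter> b = {}" if "b' \<in> P'" for b'
      using block_partition_disj[OF P \<open>b \<in> P\<close>, of b'] that x(2) by blast
    thus ?thesis using x(1) by blast
  qed (use x in blast)
  moreover have "x \<subseteq> Q" using x block_partition_subset[OF P] by blast
  ultimately show "x \<in> {x \<in> Pow Q. \<forall>b\<in>P. x \<inter> b = {} \<or> b \<subseteq> x}" by simp
qed

lemma inj_on_Union_blocks:
  assumes P: "block_partition Q P"
  shows "inj_on Union (Pow P)"
proof -
  have *: "P1 \<subseteq> P2" if "P1 \<subseteq> P" "P2 \<subseteq> P" "\<Union>P1 \<subseteq> \<Union>P2" for P1 P2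
  proof
    fix b assume b: "b \<in> P1"
    hence "b \<noteq> {}" using P \<open>P1 \<subseteq> P\<close> by (auto simp: block_partition_def)
    then obtain q where q: "q \<in> b" by blast
    then obtain b' where "b' \<in> P2" "q \<in> b'" using \<open>\<Union>P1 \<subseteq> \<Union>P2\<close> b by blast
    thus "b \<in> P2"
      using block_partition_disj[OF P, of b b' q] q b \<open>P1 \<subseteq> P\<close> \<open>P2 \<subseteq> P\<close> by blast
  qed
  show ?thesis
  proof (rule inj_onI)
    fix P1 P2 assume "P1 \<in> Pow P" "P2 \<in> Pow P" "\<Union>P1 = \<Union>P2"
    thus "P1 = P2" using *[of P1 P2] *[of P2 P1] by blast
  qed
qed

lemma block_product_eq:
  assumes "finite P"
  shows "block_product P x = (if \<forall>b\<in>P. x \<inter> b = {} \<or> b \<subseteq> x then complex_of_real (1 / sqrt 2) ^ card P else 0)"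
proof (cases "\<forall>b\<in>P. x \<inter> b = {} \<or> b \<subseteq> x")
  case True
  hence "block_product P x = (\<Prod>b\<in>P. complex_of_real (1 / sqrt 2))"
    unfolding block_product_def by (intro prod.cong) (auto simp: ghz_block_def)
  thus ?thesis using True by simp
next
  case False
  then obtain b where "b \<in> P" "\<not> (x \<inter> b = {} \<or> b \<subseteq> x)" by blast
  hence "b \<in> P" "ghz_block b x = 0" by (auto simp: ghz_block_def)
  thus ?thesis using False assms unfolding block_product_def by (auto intro: prod_zero)
qed

text \<open>The support has \<open>2 ^ card P\<close> labels, one for each set of blocks, and each
  has squared amplitude \<open>(1 / 2) ^ card P\<close>.\<close>

lemma unit_state_block_product:
  assumes fin: "finite Q" and P: "block_partition Q P"
  shows "unit_state Q (block_product P)"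
proof -
  have finP: "finite P" by (rule finite_block_partition[OF fin P])
  have "((1 / sqrt 2) ^ card P)\<^sup>2 = (1 / 2 :: real) ^ card P"
    by (simp add: power_divide flip: power_mult) (simp add: power_mult mult.commute[of _ 2])
  hence sq: "(cmod (complex_of_real (1 / sqrt 2) ^ card P))\<^sup>2 = (1 / 2) ^ card P"
    by (simp add: norm_power norm_divide)
  have "(\<Sum>x\<in>Pow Q. (cmod (block_product P x))\<^sup>2) =
      (\<Sum>x\<in>Pow Q. if \<forall>b\<in>P. x \<inter> b = {} \<or> b \<subseteq> x then (1 / 2) ^ card P else 0)"
    by (intro sum.cong refl)
      (simp add: block_product_eq[OF finP] sq if_distrib[of "\<lambda>z. (cmod z)\<^sup>2"] del: of_real_divide)
  also have "\<dots> = (\<Sum>x\<in>Union ` Pow P. (1 / 2) ^ card P)"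
    using fin by (simp only: unions_of_blocks[OF P, symmetric] sum.inter_filter finite_Pow_iff)
  also have "\<dots> = 1"
    using card_image[OF inj_on_Union_blocks[OF P]] finP by (simp add: card_Pow power_divide)
  finally show ?thesis by (simp add: unit_state_def)
qed

text \<open>Takes the place of uniqueness of the stabilizer state. Elements ZZ inside a block kill
  the amplitudes at labels that cut the block, and X on whole blocks links all other labels to
  \<open>{}\<close>. The assumptions at \<open>{}\<close> and on X settle the signs of these two
  kinds of elements.\<close>

lemma stabilized_block_product:
  assumes fin: "finite Q" and P: "block_partition Q P"
    and st: "stabilized Q (ghz_group P) \<phi>" and ne: "\<phi> {} \<noteq> 0"
    and X: "\<And>b x. b \<in> P \<Longrightarrow> x \<subseteq> Q \<Longrightarrow> pauli_act Q (restr b (\<lambda>_. (1, 0))) \<phi> x = \<phi> x"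
  obtains c where "\<And>x. x \<subseteq> Q \<Longrightarrow> \<phi> x = c * block_product P x"
proof -
  have finP: "finite P" by (rule finite_block_partition[OF fin P])
  have zero: "\<phi> x = 0" if x: "x \<subseteq> Q" and b: "b \<in> P" and q: "q \<in> b" "q \<in> x" and r: "r \<in> b" "r \<notin> x" for x b q r
  proof -
    let ?t = "single q (0, 1) + single r (0, 1)"
    have qr: "q \<noteq> r" and qrQ: "q \<in> Q" "r \<in> Q" using q r b block_partition_subset[OF P] by blast+
    have "?t \<in> ghz_group P"
    proof (rule ghz_groupI)
      show "?t \<in> Gn (\<Union>P)" using b q r by (intro Gn_add single_in_Gn) blast+
      show "fst (?t u) = fst (?t v)" for u v by (simp add: single_def)
      fix b' assume b': "b' \<in> P"
      have "(\<Sum>p\<in>b'. snd (?t p)) = (\<Sum>p\<in>b'. if p = q then 1 else 0) + (\<Sum>p\<in>b'. if p = r then 1 else 0)"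
        unfolding sum.distrib[symmetric] by (intro sum.cong) (auto simp: single_def)
      moreover have "q \<in> b' \<longleftrightarrow> r \<in> b'"
        using block_partition_disj[OF P b b'] q r by blast
      moreover have "finite b'" using block_partition_subset[OF P b'] fin finite_subset by blast
      ultimately show "(\<Sum>p\<in>b'. snd (?t p)) = 0" by simp
    qed
    then obtain e where e: "\<And>x. x \<subseteq> Q \<Longrightarrow> pauli_act Q ?t \<phi> x = e * \<phi> x"
      using st unfolding stabilized_def by blast
    have flip: "flip ?t y = y" for y by (auto simp: flip_def single_def)
    have ph: "phase Q ?t y = (if q \<in> y then -1 else 1) * (if r \<in> y then -1 else 1)" for y
    proof -
      have "phase Q ?t y = phase {q, r} ?t (y \<inter> {q, r})"
        using qrQ by (intro phase_subset fin Gn_add single_in_Gn) auto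
      thus ?thesis using qr by (simp add: phase_def single_def phase1_def sigma1_def)
    qed
    \<comment> \<open>At the label \<open>{}\<close> both Z factors are 1, so the nonzero amplitude
      there determines the sign.\<close>
    have "e = 1" using e[of "{}"] ne by (simp add: pauli_act_def flip ph)
    hence "- \<phi> x = \<phi> x" using e[OF x] q r by (simp add: pauli_act_def flip ph)
    thus ?thesis by simp
  qed
  have union: "\<phi> (\<Union>P') = \<phi> {}" if "P' \<subseteq> P" for P'
  proof -
    have "finite P'" using that finP finite_subset by blast
    thus ?thesis using that
    proof (induction P' rule: finite_induct)
      case (insert b P')
      let ?X = "restr b (\<lambda>_. (1, 0))"
      have b: "b \<in> P" "b \<subseteq> Q" and sub: "\<Union>P' \<subseteq> Q"
        using insert.prems block_partition_subset[OF P] by blast+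
      have "b \<inter> \<Union>P' = {}"
        using insert.prems insert.hyps block_partition_disj[OF P] by blast
      hence "flip ?X (\<Union>P') = \<Union>(insert b P')"
        by (auto simp: flip_def restr_apply)
      moreover have "phase Q ?X x = 1" for x
        unfolding phase_def by (rule prod.neutral) (simp add: restr_def phase1_def sigma1_def zero_prod_def)
      ultimately have "\<phi> (\<Union>(insert b P')) = \<phi> (\<Union>P')"
        using X[OF b(1) sub] by (simp add: pauli_act_def)
      thus ?case using insert by simp
    qed simp
  qed
  \<comment> \<open>The power of \<open>sqrt 2\<close> undoes the amplitude of the block product on
    its support, so both sides agree at \<open>{}\<close>.\<close>
  have "\<phi> x = (\<phi> {} * complex_of_real (sqrt 2) ^ card P) * block_product P x" if x: "x \<subseteq> Q" for x
  proof (cases "\<forall>b\<in>P. x \<inter> b = {} \<or> b \<subseteq> x")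
    case True
    hence "x \<in> Union ` Pow P" using unions_of_blocks[OF P] x by blast
    hence "\<phi> x = \<phi> {}" using union by blast
    moreover have "complex_of_real (sqrt 2) ^ card P * complex_of_real (1 / sqrt 2) ^ card P = 1"
      by (simp flip: power_mult_distrib of_real_mult)
    ultimately show ?thesis using True by (simp add: block_product_eq[OF finP] mult.assoc)
  next
    case False
    then obtain b q r where "b \<in> P" "q \<in> b" "q \<in> x" "r \<in> b" "r \<notin> x" by blast
    hence "\<phi> x = 0" using zero x by blast
    thus ?thesis unfolding block_product_eq[OF finP] if_not_P[OF False] by simp
  qed
  thus ?thesis using that by blast
qed

text \<open>Two corrections suffice. An X-type Pauli moves some label of nonzero amplitude to
  \<open>{}\<close>, which settles all signs of ZZ elements at once. A Z-type Pauli then corrects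
  the signs of X on whole blocks; it fixes the label \<open>{}\<close>, so the amplitude there stays
  nonzero.\<close>

lemma stabilized_pauli_normal_form:
  assumes fin: "finite Q" and P: "block_partition Q P"
    and st: "stabilized Q (ghz_group P) \<phi>" and unit: "unit_state Q \<phi>"
  obtains h0 h1 c where "h0 \<in> Gn Q" "h1 \<in> Gn Q"
    "\<And>x. x \<subseteq> Q \<Longrightarrow> pauli_act Q h1 (pauli_act Q h0 \<phi>) x = c * block_product P x"
proof -
  have "\<exists>x\<in>Pow Q. \<phi> x \<noteq> 0"
    using unit unfolding unit_state_def by (rule contrapos_pp) simp
  then obtain x0 where x0: "x0 \<subseteq> Q" "\<phi> x0 \<noteq> 0" by blast
  have stab_act: "stabilized Q (ghz_group P) (pauli_act Q h \<psi>)"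
    if h: "h \<in> Gn Q" and \<psi>: "stabilized Q (ghz_group P) \<psi>" for h \<psi>
    unfolding stabilized_def
  proof
    fix f assume "f \<in> ghz_group P"
    then obtain e :: complex where e: "e = 1 \<or> e = -1"
      "\<And>x. x \<subseteq> Q \<Longrightarrow> pauli_act Q f \<psi> x = e * \<psi> x"
      using \<psi> unfolding stabilized_def by blast
    let ?e = "(if omega Q f h = 0 then 1 else -1) * e"
    have "?e = 1 \<or> ?e = -1" using e(1) by auto
    moreover have "\<forall>x. x \<subseteq> Q \<longrightarrow> pauli_act Q f (pauli_act Q h \<psi>) x = ?e * pauli_act Q h \<psi> x"
      using stabilized_pauli_act[OF fin h e(2)] by blast
    ultimately show "\<exists>e. (e = 1 \<or> e = -1) \<and>
        (\<forall>x. x \<subseteq> Q \<longrightarrow> pauli_act Q f (pauli_act Q h \<psi>) x = e * pauli_act Q h \<psi> x)" by blast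
  qed
  have phase_ne: "phase Q f x \<noteq> 0" for f x using cmod_phase[of Q f x] by (metis norm_zero zero_neq_one)
  define h0 :: "'a symp" where "h0 = (\<lambda>q. if q \<in> x0 then (1, 0) else 0)"
  have h0: "h0 \<in> Gn Q" using x0 by (auto simp: h0_def Gn_def)
  define \<phi>1 where "\<phi>1 = pauli_act Q h0 \<phi>"
  have "flip h0 {} = x0" by (auto simp: flip_def h0_def)
  hence ne1: "\<phi>1 {} \<noteq> 0" using x0 phase_ne by (simp add: \<phi>1_def pauli_act_def)
  have st1: "stabilized Q (ghz_group P) \<phi>1" unfolding \<phi>1_def by (rule stab_act[OF h0 st])
  let ?X = "\<lambda>b. restr b (\<lambda>_. (1, 0)) :: 'a symp"
  have XG: "?X b \<in> ghz_group P" if b: "b \<in> P" for b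
  proof (rule ghz_groupI)
    show "?X b \<in> Gn (\<Union>P)" using Gn_mono[of b "\<Union>P"] restr_in_Gn[of b] b by blast
    show "(\<Sum>q\<in>b'. snd (?X b q)) = 0" for b' by (rule sum.neutral) (simp add: restr_apply)
    show "fst (?X b q) = fst (?X b r)" if "b' \<in> P" "q \<in> b'" "r \<in> b'" for b' q r
      using block_partition_disj[OF P b that(1)] that by (auto simp: restr_apply)
  qed
  have "\<exists>e. \<forall>b\<in>P. (e b = 1 \<or> e b = -1) \<and> (\<forall>x. x \<subseteq> Q \<longrightarrow> pauli_act Q (?X b) \<phi>1 x = e b * \<phi>1 x)"
    by (rule bchoice) (use st1 XG in \<open>simp add: stabilized_def\<close>)
  then obtain e :: "'a set \<Rightarrow> complex" where e: "\<And>b. b \<in> P \<Longrightarrow> e b = 1 \<or> e b = -1"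
    "\<And>b x. b \<in> P \<Longrightarrow> x \<subseteq> Q \<Longrightarrow> pauli_act Q (?X b) \<phi>1 x = e b * \<phi>1 x" by blast
  have "{} \<notin> P" using P by (simp add: block_partition_def)
  hence "\<forall>b\<in>P. \<exists>q. q \<in> b" by (metis ex_in_conv)
  then obtain r where r: "\<And>b. b \<in> P \<Longrightarrow> r b \<in> b" by metis
  \<comment> \<open>One Z on a chosen qubit of every block whose X has sign -1. It anticommutes with
    the X of its own block and commutes with those of all others.\<close>
  define h1 :: "'a symp" where
    "h1 = (\<lambda>q. if q \<in> r ` {b \<in> P. e b = -1} then (0, 1) else 0)"
  have h1: "h1 \<in> Gn Q"
    using r block_partition_subset[OF P] by (auto simp: h1_def Gn_def)
  have om: "omega Q (?X b) h1 = (if e b = -1 then 1 else 0)" if b: "b \<in> P" for b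
  proof -
    have bQ: "b \<subseteq> Q" by (rule block_partition_subset[OF P b])
    have "omega Q (?X b) h1 = (\<Sum>q\<in>b. fst (?X b q) * snd (h1 q) + snd (?X b q) * fst (h1 q))"
      unfolding omega_def by (rule sum.mono_neutral_right) (use fin bQ in \<open>auto simp: restr_apply\<close>)
    also have "\<dots> = (\<Sum>q\<in>b. if q = r b then (if e b = -1 then 1 else 0) else 0)"
    proof (intro sum.cong refl)
      fix q assume q: "q \<in> b"
      have "q \<in> r ` {b \<in> P. e b = -1} \<longleftrightarrow> q = r b \<and> e b = -1"
        using r b q block_partition_disj[OF P b] by blast
      thus "fst (?X b q) * snd (h1 q) + snd (?X b q) * fst (h1 q) =
          (if q = r b then (if e b = -1 then 1 else 0) else 0)"
        using q by (simp add: restr_apply h1_def)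
    qed
    also have "\<dots> = (if e b = -1 then 1 else 0)"
      using r[OF b] finite_subset[OF bQ fin] by simp
    finally show ?thesis .
  qed
  define \<phi>2 where "\<phi>2 = pauli_act Q h1 \<phi>1"
  have "flip h1 {} = {}" by (auto simp: flip_def h1_def)
  hence ne2: "\<phi>2 {} \<noteq> 0" using ne1 phase_ne by (simp add: \<phi>2_def pauli_act_def)
  have st2: "stabilized Q (ghz_group P) \<phi>2" unfolding \<phi>2_def by (rule stab_act[OF h1 st1])
  have "pauli_act Q (?X b) \<phi>2 x = \<phi>2 x" if b: "b \<in> P" and x: "x \<subseteq> Q" for b x
  proof -
    have "pauli_act Q (?X b) \<phi>2 x = ((if omega Q (?X b) h1 = 0 then 1 else -1) * e b) * \<phi>2 x"
      unfolding \<phi>2_def by (rule stabilized_pauli_act[OF fin h1 e(2)[OF b] x])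
    thus ?thesis using e(1)[OF b] by (auto simp: om[OF b])
  qed
  then obtain c where "\<And>x. x \<subseteq> Q \<Longrightarrow> \<phi>2 x = c * block_product P x"
    using stabilized_block_product[OF fin P st2 ne2] by metis
  thus ?thesis using that[OF h0 h1] unfolding \<phi>2_def \<phi>1_def by blast
qed

text \<open>The Pauli corrections are party-local rotations too, so a single list describes the
  complete circuit and splits into Clifford operators of the parties.\<close>

lemma stabilizer_state_LCU:
  assumes stab: "stabilizer_state Q S \<psi>" and hs: "\<forall>h\<in>set hs. party_local Q pty h"
    and P: "block_partition Q P" and eq: "trvs Q hs ` S = ghz_group P"
  shows "LCU_equiv Q pty \<psi> (block_product P)"
proof -
  have fin: "finite Q" and SG: "S \<subseteq> Gn Q" and unit: "unit_state Q \<psi>"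
    using stab by (auto simp: stabilizer_state_def)
  obtain \<epsilon> :: "'a symp \<Rightarrow> complex" where \<epsilon>: "\<And>f. f \<in> S \<Longrightarrow> (\<epsilon> f = 1 \<or> \<epsilon> f = -1) \<and>
        (\<forall>x\<in>Pow Q. apply_op Q (pauli Q f) \<psi> x = \<epsilon> f * \<psi> x)"
    using stab unfolding stabilizer_state_def by blast
  have "stabilized Q S \<psi>"
    unfolding stabilized_def
  proof
    fix f assume f: "f \<in> S"
    have "pauli_act Q f \<psi> x = \<epsilon> f * \<psi> x" if "x \<subseteq> Q" for x
      using \<epsilon>[OF f] that SG f by (simp add: apply_op_pauli[OF fin _ that, symmetric] subset_iff)
    thus "\<exists>e. (e = 1 \<or> e = -1) \<and> (\<forall>x. x \<subseteq> Q \<longrightarrow> pauli_act Q f \<psi> x = e * \<psi> x)"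
      using \<epsilon>[OF f] by blast
  qed
  hence st: "stabilized Q (ghz_group P) (rots Q hs \<psi>)"
    using stabilized_rots[OF fin party_local_in_Gn[OF hs]] eq by metis
  have unit': "unit_state Q (rots Q hs \<psi>)"
    by (rule unit_state_rots[OF party_local_in_Gn[OF hs] unit])
  obtain h0 h1 c where h: "h0 \<in> Gn Q" "h1 \<in> Gn Q"
    and c: "\<And>x. x \<subseteq> Q \<Longrightarrow> pauli_act Q h1 (pauli_act Q h0 (rots Q hs \<psi>)) x = c * block_product P x"
    using stabilized_pauli_normal_form[OF fin P st unit'] by metis
  obtain ks0 c0 where ks0: "\<forall>h\<in>set ks0. party_local Q pty h"
    "\<And>\<psi> x. rots Q ks0 \<psi> x = c0 * pauli_act Q h0 \<psi> x"
    using pauli_act_rots[OF fin h(1)] by metis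
  obtain ks1 c1 where ks1: "\<forall>h\<in>set ks1. party_local Q pty h"
    "\<And>\<psi> x. rots Q ks1 \<psi> x = c1 * pauli_act Q h1 \<psi> x"
    using pauli_act_rots[OF fin h(2)] by metis
  let ?hs = "hs @ ks0 @ ks1"
  let ?d = "c1 * c0 * c"
  have loc: "\<forall>h\<in>set ?hs. party_local Q pty h" using hs ks0(1) ks1(1) by auto
  have final: "rots Q ?hs \<psi> x = ?d * block_product P x" if "x \<subseteq> Q" for x
  proof -
    have "rots Q ks0 (rots Q hs \<psi>) = (\<lambda>x. c0 * pauli_act Q h0 (rots Q hs \<psi>) x)"
      using ks0(2) by blast
    thus ?thesis using c[OF that] by (simp add: ks1(2) pauli_act_scale)
  qed
  \<comment> \<open>The proportionality factor is only known to exist; as both sides are unit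
    vectors, its modulus is one.\<close>
  have "unit_state Q (rots Q ?hs \<psi>)"
    by (rule unit_state_rots[OF party_local_in_Gn[OF loc] unit])
  hence "1 = (\<Sum>x\<in>Pow Q. (cmod (?d * block_product P x))\<^sup>2)"
    using final by (simp add: unit_state_def)
  also have "\<dots> = (cmod ?d)\<^sup>2 * (\<Sum>x\<in>Pow Q. (cmod (block_product P x))\<^sup>2)"
    unfolding norm_mult[of ?d] power_mult_distrib sum_distrib_left ..
  also have "\<dots> = (cmod ?d)\<^sup>2"
    using unit_state_block_product[OF fin P] by (simp add: unit_state_def)
  finally have d: "cmod ?d = 1" by (metis norm_ge_zero power2_eq_1_iff abs_of_nonneg abs_minus_cancel abs_one)
  obtain U where "\<And>\<alpha>. clifford (qubits_of Q pty \<alpha>) (U \<alpha>)"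
    "\<And>\<psi> x. x \<subseteq> Q \<Longrightarrow> apply_op Q (local_op Q pty U) \<psi> x = rots Q ?hs \<psi> x"
    using rots_local_clifford[OF fin loc] by metis
  thus ?thesis unfolding LCU_equiv_def using final d by (metis PowD)
qed

theorem theorem5:
  fixes Q :: "'q set" and pty :: "'q \<Rightarrow> party" and S :: "'q symp set" and \<psi> :: "'q state"
  assumes stab: "stabilizer_state Q S \<psi>"
    and flr: "full_local_ranks Q pty S"
  defines "p \<equiv> int (f2dim S) - int (f2dim (S_loc Q pty S))"
    and "d \<equiv> \<lambda>\<alpha>. int (f2dim (colocal_sub Q pty S \<alpha>))"
  shows "(\<forall>\<alpha>. d \<alpha> - p \<ge> 0 \<and> even (d \<alpha> - p)) \<and>
    (\<exists>P. block_partition Q P \<and>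
       (\<forall>blk\<in>P. pair_block pty PB PC blk \<or> pair_block pty PC PA blk \<or>
                 pair_block pty PA PB blk \<or> triple_block pty blk) \<and>
       int (card {blk\<in>P. pair_block pty PB PC blk}) = (d PA - p) div 2 \<and>
       int (card {blk\<in>P. pair_block pty PC PA blk}) = (d PB - p) div 2 \<and>
       int (card {blk\<in>P. pair_block pty PA PB blk}) = (d PC - p) div 2 \<and>
       int (card {blk\<in>P. triple_block pty blk}) = p \<and>
       LCU_equiv Q pty \<psi> (block_product P))"
proof -
  have fin: "finite Q" and L: "lagrangian Q S"
    using stab by (auto simp: stabilizer_state_def lagrangian_def)
  obtain hs P where hs: "\<forall>h\<in>set hs. party_local Q pty h" and P: "block_partition Q P"
    and blk: "\<forall>blk\<in>P. inj_on pty blk \<and> card blk \<ge> 2" and eq: "trvs Q hs ` S = ghz_group P"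
    using lagrangian_normal_form[OF fin L flr] by blast
  let ?n = "\<lambda>J. card {blk\<in>P. pty ` blk = J}"
  have p: "p = int (?n UNIV)"
    unfolding p_def ghz_group_dims(2)[OF fin L hs P blk eq] by simp
  have d: "d \<alpha> = 2 * int (?n (UNIV - {\<alpha>})) + int (?n UNIV)" for \<alpha>
    unfolding d_def ghz_group_dims(1)[OF fin L hs P blk eq] by simp
  have compl: "UNIV - {PA} = {PB, PC}" "UNIV - {PB} = {PC, PA}" "UNIV - {PC} = {PA, PB}"
    by (auto simp: UNIV_party)
  have pair: "pair_block pty \<alpha> \<beta> b \<longleftrightarrow> pty ` b = {\<alpha>, \<beta>}" if "b \<in> P" for \<alpha> \<beta> b
    using blk that by (intro pair_block_iff) simp
  have triple: "triple_block pty b \<longleftrightarrow> pty ` b = UNIV" if "b \<in> P" for b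
    using blk that by (intro triple_block_iff) simp
  have types: "{blk\<in>P. pair_block pty \<alpha> \<beta> blk} = {blk\<in>P. pty ` blk = {\<alpha>, \<beta>}}"
    "{blk\<in>P. triple_block pty blk} = {blk\<in>P. pty ` blk = UNIV}" for \<alpha> \<beta>
    by (intro Collect_cong conj_cong refl pair triple; assumption)+
  have "pair_block pty PB PC b \<or> pair_block pty PC PA b \<or> pair_block pty PA PB b \<or> triple_block pty b"
    if b: "b \<in> P" for b
  proof -
    have "card (pty ` b) \<ge> 2"
      using blk b by (simp add: card_image)
    \<comment> \<open>Of the eight sets of parties, those with at least two members are the three
      pairs and the full set.\<close>
    moreover have "J = {PB, PC} \<or> J = {PC, PA} \<or> J = {PA, PB} \<or> J = UNIV" if "card J \<ge> 2" for J
    proof -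
      have "J \<in> Pow {PA, PB, PC}" by (metis PowI UNIV_party subset_UNIV)
      hence "J = {} \<or> J = {PA} \<or> J = {PB} \<or> J = {PC} \<or> J = {PB, PC} \<or> J = {PC, PA} \<or>
          J = {PA, PB} \<or> J = UNIV"
        unfolding UNIV_party Pow_insert Pow_empty image_insert image_empty Un_insert_left Un_empty_left
          insert_iff empty_iff by (metis insert_commute)
      thus ?thesis using that by (elim disjE) simp_all
    qed
    ultimately show ?thesis
      unfolding pair[OF b] triple[OF b] by blast
  qed
  moreover have "LCU_equiv Q pty \<psi> (block_product P)"
    by (rule stabilizer_state_LCU[OF stab hs P eq])
  ultimately show ?thesis
    using P by (intro conjI exI[of _ P] allI ballI) (simp_all add: types p d compl)
qed

end
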